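(* Let $k\geq 3$ be an integer. Then, for every positive integer $n$ such that $n\equiv k-1 \pmod{k^2-2k-1}$, we have $$ex_{\mathcal{OP}}(n,C_k)= \frac{(2k - 5)(kn - k - 1)}{k^2 - 2k - 1}.$$
   Context: All graphs are finite, undirected, without loops or multiple edges. A graph is outerplanar if it has a planar drawing (edge curves do not cross; they may share only endpoints) for which all vertices belong to the outer face of the drawing. $C_k$ denotes the cycle on $k$ vertices. For a graph $H$, the outerplanar Turán number $ex_{\mathcal{OP}}(n,H)$ is the maximum number of edges in an $n$-vertex outerplanar graph that does not contain $H$ as a (not necessarily induced) subgraph. *)

theory Defs
  imports "HOL-Analysis.Analysis" "HOL-Number_Theory.Cong"
begin

type_synonym 'a ugraph = "'a set \<times> 'a set set"

abbreviation vertices :: "'a ugraph \<Rightarrow> 'a set" where "vertices \<equiv> fst"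
abbreviation edges :: "'a ugraph \<Rightarrow> 'a set set" where "edges \<equiv> snd"

definition simple_graph :: "'a ugraph \<Rightarrow> bool" where
  "simple_graph G \<longleftrightarrow>
     finite (vertices G) \<and> (\<forall>e\<in>edges G. e \<subseteq> vertices G \<and> card e = 2)"

definition contains_subgraph :: "'a ugraph \<Rightarrow> 'b ugraph \<Rightarrow> bool" where
  "contains_subgraph G H \<longleftrightarrow>
     (\<exists>f. inj_on f (vertices H) \<and> f ` vertices H \<subseteq> vertices G \<and>
          (\<forall>e\<in>edges H. f ` e \<in> edges G))"

text \<open>This is the cycle on \<open>k\<close> vertices only for \<open>k \<ge> 3\<close>.\<close>
definition cycle_graph :: "nat \<Rightarrow> nat ugraph" where
  "cycle_graph k = ({..<k}, (\<lambda>i. {i, Suc i mod k}) ` {..<k})"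

text \<open>A vertex \<open>v\<close> is drawn as the point \<open>p v\<close> and an edge \<open>e\<close> as the arc \<open>\<gamma> e\<close>; the
  orientation of the arc is immaterial.\<close>
definition planar_drawing ::
    "'a ugraph \<Rightarrow> ('a \<Rightarrow> complex) \<Rightarrow> ('a set \<Rightarrow> real \<Rightarrow> complex) \<Rightarrow> bool" where
  "planar_drawing G p \<gamma> \<longleftrightarrow>
     inj_on p (vertices G) \<and>
     (\<forall>e\<in>edges G. arc (\<gamma> e) \<and> {pathstart (\<gamma> e), pathfinish (\<gamma> e)} = p ` e \<and>
                  path_image (\<gamma> e) \<inter> p ` vertices G = p ` e) \<and>
     (\<forall>e\<in>edges G. \<forall>f\<in>edges G. e \<noteq> f \<longrightarrow>
        path_image (\<gamma> e) \<inter> path_image (\<gamma> f) \<subseteq> p ` e \<inter> p ` f)"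

definition drawing_points ::
    "'a ugraph \<Rightarrow> ('a \<Rightarrow> complex) \<Rightarrow> ('a set \<Rightarrow> real \<Rightarrow> complex) \<Rightarrow> complex set" where
  "drawing_points G p \<gamma> = p ` vertices G \<union> (\<Union>e\<in>edges G. path_image (\<gamma> e))"

text \<open>The outer face is the unbounded component of the complement of the drawing, which is
  \<^term>\<open>outside (drawing_points G p \<gamma>)\<close>, as the drawing of a finite graph is compact. Faces are
  open sets disjoint from the drawing, so a vertex belongs to a face when it lies on its frontier.\<close>
definition outerplanar :: "'a ugraph \<Rightarrow> bool" where
  "outerplanar G \<longleftrightarrow>
     (\<exists>p \<gamma>. planar_drawing G p \<gamma> \<and>
            (\<forall>v\<in>vertices G. p v \<in> frontier (outside (drawing_points G p \<gamma>))))"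

text \<open>Every finite graph is isomorphic to one with vertices in \<^typ>\<open>nat\<close>. The set below is finite,
  since a simple graph on \<open>n\<close> vertices has at most \<open>n choose 2\<close> edges, and it is nonempty as soon as
  \<open>H\<close> has an edge, by the edgeless graph.\<close>
definition ex_OP :: "nat \<Rightarrow> 'b ugraph \<Rightarrow> nat" where
  "ex_OP n H = Max {card (edges G) | G :: nat ugraph.
     simple_graph G \<and> card (vertices G) = n \<and> outerplanar G \<and> \<not> contains_subgraph G H}"

end

theory Submission
  imports Defs
begin

text \<open>Upper bound. In an outerplanar drawing no vertex lies inside a closed curve of edges, so by the
  Jordan curve theorem there are no three internally disjoint paths with common ends that all have
  inner vertices, and no \<open>K\<^sub>4\<close>. Hence a graph that does not split at a set of at most one vertex
  has a Hamiltonian cycle whose chords do not cross, and the bound is additive over splits. With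
  \<open>s = k - 2\<close>, a subtree of faces whose sizes minus 2 add up to \<open>w\<close> is bounded by a cycle of length
  \<open>w + 2\<close>, so \<open>w = s\<close> is forbidden: chains of triangles have total size less than \<open>s\<close>, and the best
  way to continue them is a face of length \<open>k + 1\<close> with such a chain on each of its edges.

  Lower bound. Repeatedly glue a \<open>(k + 1)\<close>-gon to an outer edge and a triangulated \<open>(k - 1)\<close>-gon
  to each of its \<open>k\<close> new edges. A cycle either stays in one \<open>(k - 1)\<close>-gon or encloses a
  \<open>(k + 1)\<close>-gon.\<close>


section \<open>Graphs without theta subgraphs\<close>

text \<open>The constants come from one round of gluing. It adds
  \<open>(k - 1) + k * (k - 3) = k^2 - 2 * k - 1\<close> vertices, and it adds
  \<open>k * (2 * k - 5)\<close> edges, because a triangulated (k - 1)-gon has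
  \<open>2 * k - 5\<close> edges, one of them shared with the (k + 1)-gon. The residue class of
  \<open>n\<close> is that of a single triangulated (k - 1)-gon followed by complete rounds. The
  obstacle to an induction over faces is that the edge count alone is no invariant: a part rich in
  edges also offers many path lengths between the ends of its base edge, and these restrict the next
  face. So the induction records an interval of available lengths and lets the slack of the bound
  drop by \<open>s\<close> for each length beyond the shortest. Only chains of triangles keep such
  lengths; after any other face they can be forgotten without loss. Topology enters only through two
  forbidden subgraphs. After that the upper bound is combinatorial.\<close>

abbreviation is_path :: "'a set set \<Rightarrow> 'a list \<Rightarrow> bool" where
  "is_path E \<equiv> successively (\<lambda>x y. {x, y} \<in> E)"

text \<open>A violation is a subdivision of \<open>K_{2,3}\<close> whose vertices of degree three
  are \<open>a\<close> and \<open>b\<close>.\<close>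

definition theta_free :: "'a set set \<Rightarrow> bool" where
  "theta_free E \<longleftrightarrow>
     (\<forall>a b X Y Z. X \<noteq> [] \<and> Y \<noteq> [] \<and> Z \<noteq> [] \<and> distinct (a # b # X @ Y @ Z) \<longrightarrow>
        \<not> (is_path E (a # X @ [b]) \<and> is_path E (a # Y @ [b]) \<and> is_path E (a # Z @ [b])))"

lemma theta_freeD:
  assumes "theta_free E" "X \<noteq> []" "Y \<noteq> []" "Z \<noteq> []" "distinct (a # b # X @ Y @ Z)"
    "is_path E (a # X @ [b])" "is_path E (a # Y @ [b])" "is_path E (a # Z @ [b])"
  shows False
  using assms unfolding theta_free_def by blast

text \<open>Not covered by \<open>theta_free\<close>: a theta with inner vertices on all three paths
  has at least five vertices.\<close>

definition K4_free :: "'a set set \<Rightarrow> bool" where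
  "K4_free E \<longleftrightarrow>
     (\<forall>a b c d. distinct [a, b, c, d] \<longrightarrow>
        \<not> {{a, b}, {a, c}, {a, d}, {b, c}, {b, d}, {c, d}} \<subseteq> E)"

section \<open>Closed curves formed by arcs\<close>

lemma two_arcs_Jordan:
  fixes g h :: "real \<Rightarrow> complex"
  assumes "arc g" "pathstart g = a" "pathfinish g = b"
    and "arc h" "pathstart h = a" "pathfinish h = b"
    and "path_image g \<inter> path_image h = {a, b}"
  defines "C \<equiv> path_image g \<union> path_image h"
  shows "inside C \<noteq> {}" "open (inside C)" "connected (inside C)"
    "open (outside C)" "connected (outside C)" "inside C \<inter> outside C = {}"
    "inside C \<union> outside C = - C" "frontier (inside C) = C" "frontier (outside C) = C"
proof -
  have sp: "simple_path (g +++ reversepath h)"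
    using assms by (intro simple_path_join_loop) (auto simp: arc_reversepath)
  have pi: "path_image (g +++ reversepath h) = C"
    using assms by (simp add: path_image_join C_def)
  have lp: "pathfinish (g +++ reversepath h) = pathstart (g +++ reversepath h)"
    using assms by simp
  show "inside C \<noteq> {}" "open (inside C)" "connected (inside C)"
    "open (outside C)" "connected (outside C)" "inside C \<inter> outside C = {}"
    "inside C \<union> outside C = - C" "frontier (inside C) = C" "frontier (outside C) = C"
    using Jordan_inside_outside[OF sp lp] unfolding pi by simp_all
qed

lemma connected_avoiding_two_arcs:
  fixes g h :: "real \<Rightarrow> complex"
  assumes "arc g" "pathstart g = a" "pathfinish g = b"
    and "arc h" "pathstart h = a" "pathfinish h = b"
    and "path_image g \<inter> path_image h = {a, b}"
    and "connected T" "T \<inter> (path_image g \<union> path_image h) = {}"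
  shows "T \<subseteq> inside (path_image g \<union> path_image h) \<or> T \<subseteq> outside (path_image g \<union> path_image h)"
proof -
  note J = two_arcs_Jordan[OF assms(1-7)]
  have "T \<subseteq> inside (path_image g \<union> path_image h) \<union> outside (path_image g \<union> path_image h)"
    unfolding J(7) using assms(9) by blast
  then show ?thesis
    using connectedD[OF assms(8) J(2) J(4)] J(6) by blast
qed

lemma connected_arc_interior:
  assumes "arc c" "pathstart c = a" "pathfinish c = b"
  shows "connected (path_image c - {a, b})" "path_image c - {a, b} \<noteq> {}"
  using connected_simple_path_endless[OF arc_imp_simple_path[OF assms(1)]]
    nonempty_simple_path_endless[OF arc_imp_simple_path[OF assms(1)]] assms by simp_all

lemma arc_subset_closure_interior:
  fixes c :: "real \<Rightarrow> 'a::real_normed_vector"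
  assumes "arc c" "pathstart c = a" "pathfinish c = b"
  shows "path_image c \<subseteq> closure (path_image c - {a, b})"
proof -
  have "path_image c - {a, b} = c ` {0<..<1}"
    using simple_path_endless[OF arc_imp_simple_path[OF assms(1)]] assms by simp
  moreover have "c ` closure {0<..<1} \<subseteq> closure (c ` {0<..<1})"
    using assms(1) by (intro image_closure_subset) (auto simp: arc_def path_def closure_subset)
  ultimately show ?thesis by (simp add: path_image_def)
qed

text \<open>If every arc lay outside the closed curve formed by the other two, then no point inside
  \<open>c1 \<union> c2\<close> would be separated from infinity by \<open>c1 \<union> c3\<close> or by \<open>c2 \<union> c3\<close>, hence by
  Janiszewski's theorem not by the union of all three either.\<close>
lemma theta_curve_inside:
  fixes c1 c2 c3 :: "real \<Rightarrow> complex"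
  assumes c1: "arc c1" "pathstart c1 = a" "pathfinish c1 = b"
    and c2: "arc c2" "pathstart c2 = a" "pathfinish c2 = b"
    and c3: "arc c3" "pathstart c3 = a" "pathfinish c3 = b"
    and i12: "path_image c1 \<inter> path_image c2 = {a, b}"
    and i13: "path_image c1 \<inter> path_image c3 = {a, b}"
    and i23: "path_image c2 \<inter> path_image c3 = {a, b}"
  shows "path_image c1 - {a, b} \<subseteq> inside (path_image c2 \<union> path_image c3) \<or>
         path_image c2 - {a, b} \<subseteq> inside (path_image c1 \<union> path_image c3) \<or>
         path_image c3 - {a, b} \<subseteq> inside (path_image c1 \<union> path_image c2)"
proof (rule ccontr)
  define P1 P2 P3 where P: "P1 = path_image c1" "P2 = path_image c2" "P3 = path_image c3"
  assume "\<not> ?thesis"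
  note not_in = this[folded P]
  have o1: "P1 - {a, b} \<subseteq> outside (P2 \<union> P3)"
    using connected_avoiding_two_arcs[OF c2 c3 i23 connected_arc_interior(1)[OF c1]] i12 i13 not_in
    unfolding P by blast
  have o2: "P2 - {a, b} \<subseteq> outside (P1 \<union> P3)"
    using connected_avoiding_two_arcs[OF c1 c3 i13 connected_arc_interior(1)[OF c2]] i12 i23 not_in
    unfolding P by blast
  have o3: "P3 - {a, b} \<subseteq> outside (P1 \<union> P2)"
    using connected_avoiding_two_arcs[OF c1 c2 i12 connected_arc_interior(1)[OF c3]] i13 i23 not_in
    unfolding P by blast
  note J12 = two_arcs_Jordan[OF c1 c2 i12, folded P]
  note J13 = two_arcs_Jordan[OF c1 c3 i13, folded P]
  note J23 = two_arcs_Jordan[OF c2 c3 i23, folded P]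
  have comp: "compact P1" "compact P2" "compact P3"
    using c1 c2 c3 by (auto simp: P compact_path_image arc_imp_path)
  let ?I = "inside (P1 \<union> P2)"
  have I3: "?I \<inter> P3 = {}"
  proof -
    have "{a, b} \<subseteq> P1" using i12 P by blast
    then show ?thesis using o3 J12(6,7) by blast
  qed
  \<comment> \<open>An inner point of \<open>P2\<close> lies on the frontier of \<open>?I\<close>
    and in the open set \<open>outside (P1 \<union> P3)\<close>, so these two sets meet. As
    \<open>?I\<close> is connected and avoids \<open>P1\<close> and \<open>P3\<close>, it stays on
    that side.\<close>
  have I13: "?I \<subseteq> outside (P1 \<union> P3)"
  proof -
    obtain z where z: "z \<in> P2 - {a, b}"
      using connected_arc_interior(2)[OF c2] P by blast
    then have "z \<in> closure ?I" using J12(8) by (metis DiffD1 UnCI frontier_def)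
    then have "outside (P1 \<union> P3) \<inter> ?I \<noteq> {}"
      using o2 z open_Int_closure_eq_empty[OF J13(4), of ?I] by blast
    moreover have "?I \<inter> (P1 \<union> P3) = {}" using I3 J12(7) by blast
    ultimately show ?thesis
      using connected_avoiding_two_arcs[OF c1 c3 i13 J12(3)] J13(6) unfolding P by blast
  qed
  have I23: "?I \<subseteq> outside (P2 \<union> P3)"
  proof -
    obtain z where z: "z \<in> P1 - {a, b}"
      using connected_arc_interior(2)[OF c1] P by blast
    then have "z \<in> closure ?I" using J12(8) by (metis DiffD1 UnCI frontier_def)
    then have "outside (P2 \<union> P3) \<inter> ?I \<noteq> {}"
      using o1 z open_Int_closure_eq_empty[OF J23(4), of ?I] by blast
    moreover have "?I \<inter> (P2 \<union> P3) = {}" using I3 J12(7) by blast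
    ultimately show ?thesis
      using connected_avoiding_two_arcs[OF c2 c3 i23 J12(3)] J23(6) unfolding P by blast
  qed
  obtain x where x: "x \<in> ?I" using J12(1) by blast
  have "bounded (P1 \<union> P2 \<union> P3)" using comp by (simp add: compact_imp_bounded)
  then have "outside (P1 \<union> P2 \<union> P3) \<noteq> {}"
    using unbounded_outside bounded_empty by metis
  then obtain y where y: "y \<in> outside (P1 \<union> P2 \<union> P3)" by blast
  have sub: "outside C \<subseteq> - C" for C :: "complex set"
    by (auto simp: outside_def)
  have cc: "connected_component (- C) x y"
    if "connected (outside C)" "x \<in> outside C" "y \<in> outside C" for C
    using that sub by (meson connected_component_def)
  have "connected_component (- (P1 \<union> P3)) x y"
    using x I13 y outside_mono[of "P1 \<union> P3" "P1 \<union> P2 \<union> P3"] J13(5) by (intro cc) auto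
  moreover have "connected_component (- (P2 \<union> P3)) x y"
    using x I23 y outside_mono[of "P2 \<union> P3" "P1 \<union> P2 \<union> P3"] J23(5) by (intro cc) auto
  moreover have "connected ((P1 \<union> P3) \<inter> (P2 \<union> P3))"
  proof -
    have "(P1 \<union> P3) \<inter> (P2 \<union> P3) = P3" using i12 i13 i23 P by blast
    then show ?thesis using c3 P by (simp add: connected_path_image arc_imp_path)
  qed
  moreover have "compact (P1 \<union> P3)" "closed (P2 \<union> P3)"
    using comp by (simp_all add: compact_Un compact_imp_closed)
  ultimately have "connected_component (- ((P1 \<union> P3) \<union> (P2 \<union> P3))) x y"
    using Janiszewski by blast
  then have "connected_component (- (P1 \<union> P2)) x y"
    by (rule connected_component_of_subset) auto
  moreover have "y \<in> outside (P1 \<union> P2)"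
    using y outside_mono[of "P1 \<union> P2" "P1 \<union> P2 \<union> P3"] by auto
  ultimately have "x \<in> outside (P1 \<union> P2)"
    using outside_same_component connected_component_sym by metis
  then show False using x J12(6) by blast
qed

text \<open>The pattern of crossing diagonals: \<open>c\<close> joins two points of a closed curve and \<open>e\<close> joins
  two further points separated by them.\<close>
lemma no_crossing_arcs:
  fixes c1 c2 c e :: "real \<Rightarrow> complex"
  assumes c1: "arc c1" "pathstart c1 = x" "pathfinish c1 = y"
    and c2: "arc c2" "pathstart c2 = x" "pathfinish c2 = y"
    and c: "arc c" "pathstart c = x" "pathfinish c = y"
    and e: "arc e" "pathstart e = u" "pathfinish e = v"
    and i12: "path_image c1 \<inter> path_image c2 = {x, y}"
    and i1: "path_image c1 \<inter> path_image c = {x, y}"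
    and i2: "path_image c2 \<inter> path_image c = {x, y}"
    and uv: "u \<in> path_image c1 - {x, y}" "v \<in> path_image c2 - {x, y}"
    and ei: "path_image e \<inter> (path_image c1 \<union> path_image c2 \<union> path_image c) \<subseteq> {u, v}"
    and c_in: "path_image c - {x, y} \<subseteq> inside (path_image c1 \<union> path_image c2)"
    and e_in: "path_image e - {u, v} \<subseteq> inside (path_image c1 \<union> path_image c2)"
    and u_out: "u \<notin> inside (path_image c2 \<union> path_image c)"
    and v_out: "v \<notin> inside (path_image c1 \<union> path_image c)"
  shows False
proof -
  have "x \<noteq> y" using c1 arc_distinct_ends by metis
  have ne: "path_image c \<inter> inside (path_image c1 \<union> path_image c2) \<noteq> {}"
    using connected_arc_interior(2)[OF c] c_in by blast
  let ?I1 = "inside (path_image c1 \<union> path_image c)"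
  let ?I2 = "inside (path_image c2 \<union> path_image c)"
  have disj: "?I1 \<inter> ?I2 = {}"
    and un: "?I1 \<union> ?I2 \<union> (path_image c - {x, y}) = inside (path_image c1 \<union> path_image c2)"
    using split_inside_simple_closed_curve[OF arc_imp_simple_path[OF c1(1)] c1(2,3)
        arc_imp_simple_path[OF c2(1)] c2(2,3) arc_imp_simple_path[OF c(1)] c(2,3)
        \<open>x \<noteq> y\<close> i12 i1 i2 ne] by blast+
  note J1 = two_arcs_Jordan[OF c1 c i1]
  note J2 = two_arcs_Jordan[OF c2 c i2]
  have uvc: "u \<notin> path_image c2 \<union> path_image c" "v \<notin> path_image c1 \<union> path_image c"
    using uv i1 i2 i12 by blast+
  \<comment> \<open>The arc \<open>c\<close> cuts the inside into \<open>?I1\<close> and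
    \<open>?I2\<close>, and the interior of \<open>e\<close> stays in one of them. Then both ends of
    \<open>e\<close> lie in its closure, but \<open>v\<close> is not in the closure of
    \<open>?I1\<close> and \<open>u\<close> is not in that of \<open>?I2\<close>.\<close>
  have "path_image e - {u, v} \<subseteq> ?I1 \<union> ?I2" using un e_in ei by blast
  then have "path_image e - {u, v} \<subseteq> ?I1 \<or> path_image e - {u, v} \<subseteq> ?I2"
    using connectedD[OF connected_arc_interior(1)[OF e] J1(2) J2(2)] disj by blast
  then have "path_image e \<subseteq> closure ?I1 \<or> path_image e \<subseteq> closure ?I2"
    using arc_subset_closure_interior[OF e] closure_mono by blast
  moreover have "closure ?I1 = ?I1 \<union> path_image c1 \<union> path_image c"
    "closure ?I2 = ?I2 \<union> path_image c2 \<union> path_image c"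
    using J1(8) J2(8) closure_Un_frontier by blast+
  moreover have "u \<in> path_image e" "v \<in> path_image e" using e by auto
  ultimately show False using uvc u_out v_out by auto
qed

section \<open>Outerplanar drawings\<close>

fun path_edges :: "'a list \<Rightarrow> 'a set set" where
  "path_edges (x # y # zs) = insert {x, y} (path_edges (y # zs))"
| "path_edges _ = {}"

lemma is_path_iff_path_edges: "is_path E xs \<longleftrightarrow> path_edges xs \<subseteq> E"
  by (induction xs rule: path_edges.induct) auto

lemma path_edges_subset: "e \<in> path_edges xs \<Longrightarrow> e \<subseteq> set xs"
  by (induction xs rule: path_edges.induct) auto

lemma Union_path_edges: "length xs \<ge> 2 \<Longrightarrow> \<Union>(path_edges xs) = set xs"
proof (induction xs rule: path_edges.induct)
  case (1 x y zs)
  then show ?case by (cases zs) auto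
qed auto

lemma card_path_edge: "distinct xs \<Longrightarrow> e \<in> path_edges xs \<Longrightarrow> card e = 2"
  by (induction xs rule: path_edges.induct) auto

lemma ends_notin_path_edges:
  assumes "distinct (a # X @ [b])" "X \<noteq> []"
  shows "{a, b} \<notin> path_edges (a # X @ [b])"
proof -
  obtain x X' where X: "X = x # X'" using assms(2) by (cases X) auto
  then show ?thesis
    using assms(1) path_edges_subset[of "{a, b}" "x # X' @ [b]"] by (auto simp: doubleton_eq_iff)
qed

text \<open>A common edge could only be \<open>{a, b}\<close>, which a path with an inner vertex
  does not use. The case \<open>Y = []\<close> serves to compare a path with a chord.\<close>

lemma path_edges_disjoint:
  assumes "distinct (a # X @ [b])" "X \<noteq> []" "distinct (a # Y @ [b])" "set X \<inter> set Y = {}"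
  shows "path_edges (a # X @ [b]) \<inter> path_edges (a # Y @ [b]) = {}"
proof (rule ccontr)
  assume "\<not> ?thesis"
  then obtain e where e: "e \<in> path_edges (a # X @ [b])" "e \<in> path_edges (a # Y @ [b])" by blast
  have "e \<subseteq> {a, b}"
    using path_edges_subset[OF e(1)] path_edges_subset[OF e(2)] assms(4) by auto
  moreover have "card e = 2" using card_path_edge[OF assms(1) e(1)] .
  moreover have "card {a, b} = 2" using assms(1) by simp
  ultimately have "e = {a, b}" by (metis card_subset_eq finite.emptyI finite.insertI)
  then show False using e(1) ends_notin_path_edges[OF assms(1,2)] by simp
qed

section \<open>Paths of an outerplanar drawing as plane arcs\<close>

locale drawn_graph =
  fixes G :: "'a ugraph" and p :: "'a \<Rightarrow> complex" and \<gamma> :: "'a set \<Rightarrow> real \<Rightarrow> complex"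
  assumes simple: "simple_graph G" and drawing: "planar_drawing G p \<gamma>"
    and outer: "\<And>v. v \<in> vertices G \<Longrightarrow> p v \<in> frontier (outside (drawing_points G p \<gamma>))"
begin

definition curve :: "'a list \<Rightarrow> complex set" where
  "curve xs = (\<Union>e\<in>path_edges xs. path_image (\<gamma> e))"

lemma edge_subset: "e \<in> edges G \<Longrightarrow> e \<subseteq> vertices G"
  using simple by (auto simp: simple_graph_def)

lemma inj_p: "inj_on p (vertices G)"
  using drawing by (simp add: planar_drawing_def)

lemma edge_arc: "e \<in> edges G \<Longrightarrow> arc (\<gamma> e)"
  and edge_ends: "e \<in> edges G \<Longrightarrow> {pathstart (\<gamma> e), pathfinish (\<gamma> e)} = p ` e"
  and edge_vertices: "e \<in> edges G \<Longrightarrow> path_image (\<gamma> e) \<inter> p ` vertices G = p ` e"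
  using drawing by (simp_all add: planar_drawing_def)

lemma edge_Int:
  assumes "e \<in> edges G" "f \<in> edges G" "e \<noteq> f"
  shows "path_image (\<gamma> e) \<inter> path_image (\<gamma> f) \<subseteq> p ` (e \<inter> f)"
proof -
  have "p ` e \<inter> p ` f = p ` (e \<inter> f)"
    using inj_on_image_Int[OF inj_p] edge_subset assms(1,2) by metis
  moreover have "path_image (\<gamma> e) \<inter> path_image (\<gamma> f) \<subseteq> p ` e \<inter> p ` f"
    using drawing assms unfolding planar_drawing_def by blast
  ultimately show ?thesis by simp
qed

lemma curve_Int:
  assumes "is_path (edges G) xs" "is_path (edges G) ys" "path_edges xs \<inter> path_edges ys = {}"
  shows "curve xs \<inter> curve ys \<subseteq> p ` (set xs \<inter> set ys)"
proof
  fix z assume "z \<in> curve xs \<inter> curve ys"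
  then obtain e f where ef: "e \<in> path_edges xs" "f \<in> path_edges ys"
    and z: "z \<in> path_image (\<gamma> e)" "z \<in> path_image (\<gamma> f)"
    unfolding curve_def by blast
  have "z \<in> p ` (e \<inter> f)"
    using edge_Int[of e f] ef z assms by (auto simp: is_path_iff_path_edges)
  then show "z \<in> p ` (set xs \<inter> set ys)"
    using path_edges_subset[OF ef(1)] path_edges_subset[OF ef(2)] by blast
qed

lemma curve_vertices:
  assumes "is_path (edges G) xs" "length xs \<ge> 2"
  shows "p ` set xs \<subseteq> curve xs"
proof
  fix z assume "z \<in> p ` set xs"
  then obtain x e where "x \<in> e" "e \<in> path_edges xs" "z = p x"
    using Union_path_edges[OF assms(2)] by blast
  then show "z \<in> curve xs"
    using edge_vertices[of e] assms(1) unfolding curve_def is_path_iff_path_edges by blast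
qed

lemma edge_arc_from:
  assumes "{x, y} \<in> edges G" "x \<noteq> y"
  obtains g where "arc g" "pathstart g = p x" "pathfinish g = p y"
    "path_image g = path_image (\<gamma> {x, y})"
proof (cases "pathstart (\<gamma> {x, y}) = p x")
  case True
  then have "pathfinish (\<gamma> {x, y}) = p y"
    using edge_ends[OF assms(1)] arc_distinct_ends[OF edge_arc[OF assms(1)]]
    by (auto simp: doubleton_eq_iff)
  then show ?thesis using that True edge_arc[OF assms(1)] by blast
next
  case False
  then have "pathstart (\<gamma> {x, y}) = p y" "pathfinish (\<gamma> {x, y}) = p x"
    using edge_ends[OF assms(1)] by (auto simp: doubleton_eq_iff)
  then show ?thesis
    using that[of "reversepath (\<gamma> {x, y})"] edge_arc[OF assms(1)] by (simp add: arc_reversepath)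
qed

lemma curve_arc:
  assumes "distinct xs" "length xs \<ge> 2" "is_path (edges G) xs"
  shows "\<exists>g. arc g \<and> pathstart g = p (hd xs) \<and> pathfinish g = p (last xs) \<and> path_image g = curve xs"
  using assms
proof (induction xs rule: path_edges.induct)
  case (1 x y zs)
  have xy: "{x, y} \<in> edges G" "x \<noteq> y" using "1.prems" by auto
  obtain g where g: "arc g" "pathstart g = p x" "pathfinish g = p y"
    "path_image g = path_image (\<gamma> {x, y})"
    using edge_arc_from[OF xy] by blast
  show ?case
  proof (cases zs)
    case Nil
    then show ?thesis using g by (auto simp: curve_def)
  next
    case (Cons z zs')
    obtain h where h: "arc h" "pathstart h = p y" "pathfinish h = p (last (y # zs))"
      "path_image h = curve (y # zs)"
      using "1.IH" "1.prems" Cons by auto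
    have "curve [x, y] \<inter> curve (y # zs) \<subseteq> p ` (set [x, y] \<inter> set (y # zs))"
      using "1.prems" path_edges_subset[of "{x, y}" "y # zs"] by (intro curve_Int) auto
    also have "set [x, y] \<inter> set (y # zs) = {y}" using "1.prems" by auto
    finally have "path_image g \<inter> path_image h \<subseteq> {p y}"
      using g(4) h(4) by (simp add: curve_def)
    then have "arc (g +++ h)" using g h by (intro arc_join) auto
    moreover have "path_image (g +++ h) = curve (x # y # zs)"
      using g h by (simp add: path_image_join curve_def)
    ultimately show ?thesis using g h Cons
      by (intro exI[of _ "g +++ h"]) auto
  qed
qed auto

lemma path_in_vertices:
  assumes "is_path (edges G) xs" "length xs \<ge> 2"
  shows "set xs \<subseteq> vertices G"
  using Union_path_edges[OF assms(2)] assms(1) edge_subset unfolding is_path_iff_path_edges by blast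

lemma curve_subset_drawing: "is_path (edges G) xs \<Longrightarrow> curve xs \<subseteq> drawing_points G p \<gamma>"
  by (auto simp: is_path_iff_path_edges curve_def drawing_points_def)

text \<open>Passing from the drawing to a part \<open>C\<close> of it enlarges the outside, so a
  vertex lies in the closure of \<open>outside C\<close>, which misses \<open>inside C\<close>. This
  is the only use of the outer face condition.\<close>

lemma vertex_not_inside:
  assumes "v \<in> vertices G" "closed C" "C \<subseteq> drawing_points G p \<gamma>"
  shows "p v \<notin> inside C"
proof -
  have "p v \<in> closure (outside (drawing_points G p \<gamma>))"
    using outer[OF assms(1)] by (simp add: frontier_def)
  also have "\<dots> \<subseteq> closure (outside C)" by (intro closure_mono outside_mono assms(3))
  also have "\<dots> \<subseteq> C \<union> outside C" by (rule closure_outside_subset[OF assms(2)])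
  finally show ?thesis using inside_Int_outside[of C] inside_no_overlap[of C] by blast
qed

text \<open>One of the three arcs lies inside the closed curve formed by the other two, and an arc with a
  vertex in its interior cannot.\<close>
lemma theta_paths:
  assumes d: "distinct (a # b # X @ Y @ Z)" and XY: "X \<noteq> []" "Y \<noteq> []"
    and pX: "is_path (edges G) (a # X @ [b])"
    and pY: "is_path (edges G) (a # Y @ [b])"
    and pZ: "is_path (edges G) (a # Z @ [b])"
  obtains c1 c2 c3 where
    "arc c1" "pathstart c1 = p a" "pathfinish c1 = p b" "path_image c1 = curve (a # X @ [b])"
    "arc c2" "pathstart c2 = p a" "pathfinish c2 = p b" "path_image c2 = curve (a # Y @ [b])"
    "arc c3" "pathstart c3 = p a" "pathfinish c3 = p b" "path_image c3 = curve (a # Z @ [b])"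
    "path_image c1 \<inter> path_image c2 = {p a, p b}"
    "path_image c1 \<inter> path_image c3 = {p a, p b}"
    "path_image c2 \<inter> path_image c3 = {p a, p b}"
    "Z = []" "path_image c3 - {p a, p b} \<subseteq> inside (path_image c1 \<union> path_image c2)"
proof -
  obtain c1 where c1: "arc c1" "pathstart c1 = p a" "pathfinish c1 = p b"
    "path_image c1 = curve (a # X @ [b])"
    using curve_arc[of "a # X @ [b]"] d pX by auto
  obtain c2 where c2: "arc c2" "pathstart c2 = p a" "pathfinish c2 = p b"
    "path_image c2 = curve (a # Y @ [b])"
    using curve_arc[of "a # Y @ [b]"] d pY by auto
  obtain c3 where c3: "arc c3" "pathstart c3 = p a" "pathfinish c3 = p b"
    "path_image c3 = curve (a # Z @ [b])"
    using curve_arc[of "a # Z @ [b]"] d pZ by auto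
  have Int: "curve (a # U @ [b]) \<inter> curve (a # W @ [b]) = {p a, p b}"
    if "U \<noteq> []" "distinct (a # b # U @ W)" "is_path (edges G) (a # U @ [b])"
      "is_path (edges G) (a # W @ [b])" for U W
  proof
    have "path_edges (a # U @ [b]) \<inter> path_edges (a # W @ [b]) = {}"
      using that by (intro path_edges_disjoint) auto
    then have "curve (a # U @ [b]) \<inter> curve (a # W @ [b]) \<subseteq> p ` (set (a # U @ [b]) \<inter> set (a # W @ [b]))"
      using that by (intro curve_Int) auto
    also have "set (a # U @ [b]) \<inter> set (a # W @ [b]) = {a, b}" using that by auto
    finally show "curve (a # U @ [b]) \<inter> curve (a # W @ [b]) \<subseteq> {p a, p b}" by simp
  next
    show "{p a, p b} \<subseteq> curve (a # U @ [b]) \<inter> curve (a # W @ [b])"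
      using curve_vertices[OF that(3)] curve_vertices[OF that(4)] by simp
  qed
  have ints: "path_image c1 \<inter> path_image c2 = {p a, p b}"
    "path_image c1 \<inter> path_image c3 = {p a, p b}"
    "path_image c2 \<inter> path_image c3 = {p a, p b}"
  proof -
    have "distinct (a # b # X @ Y)" "distinct (a # b # X @ Z)" "distinct (a # b # Y @ Z)"
      using d by auto
    then show "path_image c1 \<inter> path_image c2 = {p a, p b}"
      "path_image c1 \<inter> path_image c3 = {p a, p b}"
      "path_image c2 \<inter> path_image c3 = {p a, p b}"
      unfolding c1 c2 c3 using XY pX pY pZ Int by blast+
  qed
  have closed: "closed (curve (a # X @ [b]))" "closed (curve (a # Y @ [b]))"
    "closed (curve (a # Z @ [b]))"
    using c1 c2 c3 closed_path_image[OF arc_imp_path] by metis+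
  have no: "\<not> curve (a # U @ [b]) - {p a, p b} \<subseteq> inside C"
    if U: "U \<noteq> []" "distinct (a # b # U)" "is_path (edges G) (a # U @ [b])"
      and C: "closed C" "C \<subseteq> drawing_points G p \<gamma>" for U C
  proof -
    obtain u where "u \<in> set U" using U by (cases U) auto
    moreover have vs: "set (a # U @ [b]) \<subseteq> vertices G" using path_in_vertices[OF U(3)] by simp
    moreover have "p u \<in> curve (a # U @ [b])"
      using curve_vertices[OF U(3)] \<open>u \<in> set U\<close> by auto
    moreover have "p u \<noteq> p a" "p u \<noteq> p b"
      using inj_p vs \<open>u \<in> set U\<close> U(2) by (auto dest!: inj_onD)
    ultimately show ?thesis using vertex_not_inside[OF _ C, of u] by auto
  qed
  note subs = curve_subset_drawing[OF pX] curve_subset_drawing[OF pY] curve_subset_drawing[OF pZ]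
  have n1: "\<not> path_image c1 - {p a, p b} \<subseteq> inside (path_image c2 \<union> path_image c3)"
    unfolding c1 c2 c3 using d XY pX closed subs by (intro no) auto
  have n2: "\<not> path_image c2 - {p a, p b} \<subseteq> inside (path_image c1 \<union> path_image c3)"
    unfolding c1 c2 c3 using d XY pY closed subs by (intro no) auto
  have n3: "\<not> path_image c3 - {p a, p b} \<subseteq> inside (path_image c1 \<union> path_image c2)" if "Z \<noteq> []"
    unfolding c1 c2 c3 using d pZ closed subs that by (intro no) auto
  have "path_image c3 - {p a, p b} \<subseteq> inside (path_image c1 \<union> path_image c2)"
    using theta_curve_inside[OF c1(1-3) c2(1-3) c3(1-3) ints] n1 n2 by blast
  moreover from this have "Z = []" using n3 by blast
  ultimately show ?thesis by (intro that[OF c1 c2 c3 ints])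
qed

lemma theta_free_edges: "theta_free (edges G)"
  unfolding theta_free_def
proof (intro allI impI notI)
  fix a b X Y Z
  assume *: "X \<noteq> [] \<and> Y \<noteq> [] \<and> Z \<noteq> [] \<and> distinct (a # b # X @ Y @ Z)"
    "is_path (edges G) (a # X @ [b]) \<and> is_path (edges G) (a # Y @ [b]) \<and> is_path (edges G) (a # Z @ [b])"
  then have "distinct (a # b # X @ Y @ Z)" "X \<noteq> []" "Y \<noteq> []" "is_path (edges G) (a # X @ [b])"
    "is_path (edges G) (a # Y @ [b])" "is_path (edges G) (a # Z @ [b])"
    by blast+
  from theta_paths[OF this] show False using * by blast
qed

text \<open>\<open>theta_paths\<close> with an empty third path puts each diagonal of the 4-cycle
  \<open>a\<close>, \<open>b\<close>, \<open>c\<close>, \<open>d\<close> inside that cycle, where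
  the two diagonals would have to cross.\<close>

lemma K4_free_edges: "K4_free (edges G)"
  unfolding K4_free_def
proof (intro allI impI notI)
  fix a b c d
  assume dist: "distinct [a, b, c, d]"
    and E: "{{a, b}, {a, c}, {a, d}, {b, c}, {b, d}, {c, d}} \<subseteq> edges G"
  have E': "{x, y} \<in> edges G" if "x \<in> {a, b, c, d}" "y \<in> {a, b, c, d}" "x \<noteq> y" for x y
    using that E by (auto simp: insert_commute)
  have V: "{a, b, c, d} \<subseteq> vertices G" using E edge_subset by auto
  have "distinct [a, c, b, d]" "[b] \<noteq> []" "[d] \<noteq> []" "is_path (edges G) [a, b, c]"
    "is_path (edges G) [a, d, c]" "is_path (edges G) [a, c]"
    using dist E' by auto
  note th1 = theta_paths[of a c "[b]" "[d]" "[]", unfolded append_Nil append_Cons, OF this]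
  have "distinct [b, d, a, c]" "[a] \<noteq> []" "[c] \<noteq> []" "is_path (edges G) [b, a, d]"
    "is_path (edges G) [b, c, d]" "is_path (edges G) [b, d]"
    using dist E' by auto
  note th2 = theta_paths[of b d "[a]" "[c]" "[]", unfolded append_Nil append_Cons, OF this]
  obtain c1 c2 c3 where
    c1: "arc c1" "pathstart c1 = p a" "pathfinish c1 = p c" "path_image c1 = curve [a, b, c]"
    and c2: "arc c2" "pathstart c2 = p a" "pathfinish c2 = p c" "path_image c2 = curve [a, d, c]"
    and c3: "arc c3" "pathstart c3 = p a" "pathfinish c3 = p c" "path_image c3 = curve [a, c]"
    and i: "path_image c1 \<inter> path_image c2 = {p a, p c}"
    "path_image c1 \<inter> path_image c3 = {p a, p c}"
    "path_image c2 \<inter> path_image c3 = {p a, p c}"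
    and in3: "path_image c3 - {p a, p c} \<subseteq> inside (path_image c1 \<union> path_image c2)"
    by (rule th1) (rule that)
  obtain e1 e2 e3 where
    e1: "path_image e1 = curve [b, a, d]" and e2: "path_image e2 = curve [b, c, d]"
    and e3: "arc e3" "pathstart e3 = p b" "pathfinish e3 = p d" "path_image e3 = curve [b, d]"
    and ein: "path_image e3 - {p b, p d} \<subseteq> inside (path_image e1 \<union> path_image e2)"
    by (rule th2) (rule that; assumption)
  have cyc: "path_image e1 \<union> path_image e2 = path_image c1 \<union> path_image c2"
    unfolding e1 e2 c1 c2 by (auto simp: curve_def insert_commute)
  have pd: "p b \<noteq> p a" "p b \<noteq> p c" "p d \<noteq> p a" "p d \<noteq> p c"
    using inj_p V dist by (auto dest!: inj_onD)
  have paths: "is_path (edges G) [a, b, c]" "is_path (edges G) [a, d, c]"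
    "is_path (edges G) [a, c]" "is_path (edges G) [b, d]"
    using E' dist by auto
  have on: "p b \<in> path_image c1 - {p a, p c}" "p d \<in> path_image c2 - {p a, p c}"
    using curve_vertices[OF paths(1)] curve_vertices[OF paths(2)] pd unfolding c1 c2 by auto
  have ei: "path_image e3 \<inter> (path_image c1 \<union> path_image c2 \<union> path_image c3) \<subseteq> {p b, p d}"
  proof -
    have "curve [b, d] \<inter> curve [a, b, c] \<subseteq> p ` (set [b, d] \<inter> set [a, b, c])"
      "curve [b, d] \<inter> curve [a, d, c] \<subseteq> p ` (set [b, d] \<inter> set [a, d, c])"
      "curve [b, d] \<inter> curve [a, c] \<subseteq> p ` (set [b, d] \<inter> set [a, c])"
      using paths dist by (intro curve_Int; auto simp: doubleton_eq_iff)+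
    then show ?thesis unfolding e3 c1 c2 c3 using dist by auto
  qed
  have closed: "closed (path_image c1)" "closed (path_image c2)" "closed (path_image c3)"
    using c1 c2 c3 closed_path_image[OF arc_imp_path] by metis+
  have "p b \<notin> inside (path_image c2 \<union> path_image c3)"
    "p d \<notin> inside (path_image c1 \<union> path_image c3)"
    using closed V curve_subset_drawing[OF paths(1)] curve_subset_drawing[OF paths(2)]
      curve_subset_drawing[OF paths(3)] c1 c2 c3
    by (intro vertex_not_inside; auto)+
  then show False
    using no_crossing_arcs[OF c1(1-3) c2(1-3) c3(1-3) e3(1-3) i on ei in3 ein[unfolded cyc]] by blast
qed

end

lemma outerplanar_theta_K4_free:
  assumes "simple_graph G" "outerplanar G"
  shows "theta_free (edges G)" "K4_free (edges G)"
proof -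
  obtain p \<gamma> where "drawn_graph G p \<gamma>"
    using assms unfolding outerplanar_def drawn_graph_def by blast
  then show "theta_free (edges G)" "K4_free (edges G)"
    using drawn_graph.theta_free_edges drawn_graph.K4_free_edges by blast+
qed

section \<open>Noncrossing chords of a polygon\<close>

text \<open>The numbers are positions along a Hamiltonian cycle. Monotonicity keeps paths over
  adjacent intervals disjoint up to their common end, so they can be concatenated, and an edge from
  \<open>a\<close> to \<open>b\<close> closes such a path to a cycle on \<open>l + 1\<close>
  vertices.\<close>

definition mono_path :: "(nat \<Rightarrow> nat \<Rightarrow> bool) \<Rightarrow> nat \<Rightarrow> nat \<Rightarrow> nat \<Rightarrow> bool" where
  "mono_path A a b l \<longleftrightarrow>
     (\<exists>xs. length xs = Suc l \<and> hd xs = a \<and> last xs = b \<and> sorted_wrt (<) xs \<and> successively A xs)"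

lemma mono_path_edge: "a < b \<Longrightarrow> A a b \<Longrightarrow> mono_path A a b 1"
  unfolding mono_path_def by (intro exI[of _ "[a, b]"]) simp

lemma mono_path_append:
  assumes "mono_path A a m l" "mono_path A m b l'"
  shows "mono_path A a b (l + l')"
proof -
  obtain xs where xs: "length xs = Suc l" "hd xs = a" "last xs = m" "sorted_wrt (<) xs" "successively A xs"
    using assms(1) by (auto simp: mono_path_def)
  obtain ys where ys: "length ys = Suc l'" "hd ys = m" "last ys = b" "sorted_wrt (<) ys" "successively A ys"
    using assms(2) by (auto simp: mono_path_def)
  obtain zs where zs: "ys = m # zs" using ys(1,2) by (cases ys) auto
  obtain us where us: "xs = us @ [m]" using xs(1,3) by (cases xs rule: rev_cases) auto
  have "sorted_wrt (<) (us @ m # zs)"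
    using xs(4) ys(4) by (force simp: us zs sorted_wrt_append)
  moreover have "successively A (us @ m # zs)"
    using xs(5) ys(5) by (auto simp: us zs successively_append_iff)
  moreover have "length (us @ m # zs) = Suc (l + l')" using xs ys by (simp add: us zs)
  moreover have "hd (us @ m # zs) = a" using xs(2) by (cases us) (auto simp: us)
  moreover have "last (us @ m # zs) = b" using ys(3) by (simp add: zs)
  ultimately show ?thesis unfolding mono_path_def by blast
qed

definition edges_between :: "(nat \<Rightarrow> nat \<Rightarrow> bool) \<Rightarrow> nat \<Rightarrow> nat \<Rightarrow> (nat \<times> nat) set" where
  "edges_between A a b = {(i, j). a \<le> i \<and> i < j \<and> j \<le> b \<and> A i j}"

lemma finite_edges_between [simp]: "finite (edges_between A a b)"
  by (rule finite_subset[of _ "{a..b} \<times> {a..b}"]) (auto simp: edges_between_def)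

text \<open>Meant for the farthest neighbour \<open>m\<close> of \<open>a\<close> before
  \<open>b\<close>. An edge over \<open>m\<close> that starts at \<open>a\<close> must be
  \<open>(a, b)\<close>, and one that starts later would cross the edge from \<open>a\<close> to
  \<open>m\<close>.\<close>

lemma edges_between_split:
  assumes "a < m" "m < b" "A a m"
    and max: "\<And>j. A a j \<Longrightarrow> j < b \<Longrightarrow> j \<le> m"
    and nc: "\<And>c d. a < c \<Longrightarrow> c < m \<Longrightarrow> m < d \<Longrightarrow> d \<le> b \<Longrightarrow> \<not> A c d"
  shows "edges_between A a b = edges_between A a m \<union> edges_between A m b \<union>
           (if A a b then {(a, b)} else {})"
    and "card (edges_between A a b) =
           card (edges_between A a m) + card (edges_between A m b) + (if A a b then 1 else 0)"
proof -
  have "i < m \<and> m < j \<Longrightarrow> i = a \<and> j = b" if "a \<le> i" "i < j" "j \<le> b" "A i j" for i j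
    using max[of j] nc[of i j] that by (cases "i = a"; cases "j = b") auto
  then show eq: "edges_between A a b = edges_between A a m \<union> edges_between A m b \<union>
           (if A a b then {(a, b)} else {})"
    using assms(1,2) by (force simp: edges_between_def)
  have "edges_between A a m \<inter> edges_between A m b = {}"
    by (auto simp: edges_between_def)
  moreover have "(a, b) \<notin> edges_between A a m \<union> edges_between A m b"
    using assms(1,2) by (auto simp: edges_between_def)
  ultimately show "card (edges_between A a b) =
           card (edges_between A a m) + card (edges_between A m b) + (if A a b then 1 else 0)"
    unfolding eq by (simp add: card_Un_disjoint)
qed

text \<open>The arithmetic of closing a face with \<open>w + 2\<close> edges whose outer sides carry chains of
  triangles of total size \<open>Q\<close>. Since no path with \<open>s + 1\<close> edges may be closed to a cycle, either
  the face alone is too long (\<open>w > s\<close>) or face and triangles together are too short.\<close>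
lemma close_face_arith:
  fixes s w Q g :: int
  assumes "s \<ge> 1" "w \<ge> 1" "Q \<ge> 0" "Q \<le> (w + 1) * (s - 1)"
    and g: "g \<ge> (w + 1) * (s * (s - 1)) - s * Q + (2 * s - 1) * w"
    and sw: "s < w \<or> w + Q < s"
  shows "g - (s^2 + 2 * s - 1) \<ge> s * (s - 1) - s * (if w = 1 \<and> w + Q < s then Q + 1 else 0)"
proof (cases "s < w")
  case True
  \<comment> \<open>Even for the largest \<open>Q\<close>, what remains of \<open>g\<close> is
    \<open>(2 * s - 1) * w\<close>. The worst case is \<open>w = s + 1\<close>, the (k + 1)-gon with
    a full chain on each side, and there the estimate is an equality.\<close>
  have "s * Q \<le> s * ((w + 1) * (s - 1))" using assms by (intro mult_left_mono) auto
  moreover have "(2 * s - 1) * (s + 1) \<le> (2 * s - 1) * w" using True assms by (intro mult_left_mono) auto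
  moreover have "w \<noteq> 1" using True assms by simp
  ultimately show ?thesis using g True
    by (simp add: algebra_simps power2_eq_square)
next
  case False
  then have Q: "w + Q < s" using sw by simp
  show ?thesis
  proof (cases "w = 1")
    case True
    \<comment> \<open>A triangle is tight as well: its closing edge makes one more length available
      and costs exactly \<open>s\<close>.\<close>
    then show ?thesis using g Q by (simp add: algebra_simps power2_eq_square)
  next
    case False
    \<comment> \<open>Faces of intermediate size are wasteful. Here \<open>g\<close> is at least
      \<open>w * (s^2 + 2 * s - 1)\<close>, so with \<open>w \<ge> 2\<close> enough remains after
      paying for one edge even if all extra lengths are forgotten.\<close>
    have "s * Q \<le> s * (s - 1 - w)" using assms Q by (intro mult_left_mono) auto
    moreover have "1 * (s^2 + 2 * s - 1) \<le> (w - 1) * (s^2 + 2 * s - 1)"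
      using assms False zero_le_power2[of s] by (intro mult_right_mono) linarith+
    ultimately show ?thesis using g False assms
      by (simp add: algebra_simps power2_eq_square)
  qed
qed

text \<open>A path of \<open>s + 1\<close> edges closed by an edge is a cycle on
  \<open>s + 2 = k\<close> vertices. A single edge is the case \<open>N = 1\<close>, where
  \<open>side\<close> and \<open>last_side\<close> coincide.\<close>

locale noncrossing_polygon =
  fixes s N :: nat and A :: "nat \<Rightarrow> nat \<Rightarrow> bool"
  assumes s: "s \<ge> 1" and N: "N \<ge> 1"
    and side: "i < N \<Longrightarrow> A i (Suc i)"
    and last_side: "A 0 N"
    and noncrossing: "a < c \<Longrightarrow> c < b \<Longrightarrow> b < d \<Longrightarrow> d \<le> N \<Longrightarrow> A a b \<Longrightarrow> \<not> A c d"
    and no_path: "a < b \<Longrightarrow> b \<le> N \<Longrightarrow> A a b \<Longrightarrow> \<not> mono_path A a b (s + 1)"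
begin

text \<open>Peeling off the longest edge at \<open>a\<close> walks along the face below the edge \<open>{a, b}\<close>: \<open>w + 1\<close>
  counts the edges of the walk, and \<open>Q\<close> the triangles by which it can be lengthened one edge at a
  time.\<close>
lemma interval_bound:
  assumes "a < b" "b \<le> N"
  shows "\<exists>w Q. (\<forall>l. w + 1 \<le> l \<and> l \<le> w + 1 + Q \<longrightarrow> mono_path A a b l) \<and>
     int Q \<le> (int w + 1) * (int s - 1) \<and> (A a b \<longrightarrow> w = 0) \<and>
     (2 * int s - 1) * ((int s + 2) * (int b - int a) - 1) -
       ((int s)^2 + 2 * int s - 1) * int (card (edges_between A a b)) \<ge>
     (int w + 1) * (int s * (int s - 1)) - int s * int Q + (2 * int s - 1) * int w"
  using assms
proof (induction "b - a" arbitrary: a b rule: less_induct)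
  case less
  \<comment> \<open>The slack of the desired bound on an interval. Adding the slacks of two adjacent
    intervals counts the constant \<open>- 1\<close> twice, whence the summand
    \<open>2 * s - 1\<close> in \<open>g\<close> below.\<close>
  let ?\<Gamma> = "\<lambda>a b. (2 * int s - 1) * ((int s + 2) * (int b - int a) - 1) -
       ((int s)^2 + 2 * int s - 1) * int (card (edges_between A a b))"
  show ?case
  proof (cases "b = Suc a")
    case True
    have "edges_between A a b = {(a, b)}"
      using side[of a] less.prems True by (auto simp: edges_between_def)
    then have "?\<Gamma> a b = int s * (int s - 1)" using True
      by (simp add: algebra_simps power2_eq_square)
    moreover have "mono_path A a b 1" using True side[of a] less.prems by (intro mono_path_edge) auto
    moreover have "l = 1" if "0 + 1 \<le> l" "l \<le> 0 + 1 + 0" for l :: nat using that by simp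
    ultimately show ?thesis using s by (intro exI[of _ 0]) auto
  next
    case False
    define m where "m = Max {j. A a j \<and> a < j \<and> j < b}"
    have fin: "finite {j. A a j \<and> a < j \<and> j < b}" by simp
    have ne: "Suc a \<in> {j. A a j \<and> a < j \<and> j < b}" using less.prems False side[of a] by auto
    have "m \<in> {j. A a j \<and> a < j \<and> j < b}" using Max_in[OF fin] ne unfolding m_def by blast
    then have m: "A a m" "a < m" "m < b" by auto
    have max: "j \<le> m" if "A a j" "j < b" for j
    proof (cases "a < j")
      case True
      then show ?thesis using Max_ge[OF fin, of j] that unfolding m_def by blast
    qed (use m in simp)
    have "m - a < b - a" "m \<le> N" using m less.prems by auto
    from less.hyps[OF this(1) m(2) this(2)] obtain w1 Q1 where 1: "\<And>l. w1 + 1 \<le> l \<Longrightarrow> l \<le> w1 + 1 + Q1 \<Longrightarrow> mono_path A a m l"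
      "int Q1 \<le> (int w1 + 1) * (int s - 1)" "A a m \<longrightarrow> w1 = 0"
      "?\<Gamma> a m \<ge> (int w1 + 1) * (int s * (int s - 1)) - int s * int Q1 + (2 * int s - 1) * int w1"
      by blast
    have w1: "w1 = 0" using 1 m by simp
    have "b - m < b - a" using m by auto
    from less.hyps[OF this m(3) less.prems(2)] obtain w2 Q2 where 2: "\<And>l. w2 + 1 \<le> l \<Longrightarrow> l \<le> w2 + 1 + Q2 \<Longrightarrow> mono_path A m b l"
      "int Q2 \<le> (int w2 + 1) * (int s - 1)"
      "?\<Gamma> m b \<ge> (int w2 + 1) * (int s * (int s - 1)) - int s * int Q2 + (2 * int s - 1) * int w2"
      by blast
    \<comment> \<open>The edge from \<open>a\<close> to \<open>m\<close> is one side of the current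
      face, and the walk from \<open>m\<close> to \<open>b\<close> supplies the others.\<close>
    define w Q where "w = w2 + 1" and "Q = Q1 + Q2"
    have paths: "mono_path A a b l" if l: "w + 1 \<le> l" "l \<le> w + 1 + Q" for l
    proof -
      \<comment> \<open>The excess of \<open>l\<close> over the shortest length is absorbed first by
        the chain on the edge from \<open>a\<close> to \<open>m\<close>; the walk from
        \<open>m\<close> to \<open>b\<close> takes the rest.\<close>
      define l1 where "l1 = 1 + min Q1 (l - w - 1)"
      have "mono_path A a m l1" using w1 by (intro 1) (auto simp: l1_def)
      moreover have "mono_path A m b (l - l1)"
        using l by (intro 2) (auto simp: l1_def w_def Q_def min_def)
      ultimately have "mono_path A a b (l1 + (l - l1))" by (rule mono_path_append)
      moreover have "l1 \<le> l" using l by (auto simp: l1_def)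
      ultimately show ?thesis by simp
    qed
    have Qle: "int Q \<le> (int w + 1) * (int s - 1)"
      using 1(2) 2(2) w1 by (simp add: w_def Q_def algebra_simps)
    note card = edges_between_split(2)[of a m b A, OF m(2,3,1) max]
    define g where "g = ?\<Gamma> a m + ?\<Gamma> m b + (2 * int s - 1)"
    have g: "g \<ge> (int w + 1) * (int s * (int s - 1)) - int s * int Q + (2 * int s - 1) * int w"
      using 1(4) 2(3) w1 by (simp add: g_def w_def Q_def algebra_simps)
    have \<Gamma>: "?\<Gamma> a b = g - (if A a b then (int s)^2 + 2 * int s - 1 else 0)"
      using card noncrossing[of a _ m] m less.prems by (simp add: g_def algebra_simps split: if_splits)
    show ?thesis
    proof (cases "A a b")
      case False
      then have "?\<Gamma> a b = g" using \<Gamma> by simp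
      then show ?thesis using paths Qle g False by (intro exI[of _ w] exI[of _ Q]) auto
    next
      case True
      have edge: "mono_path A a b 1" using True less.prems by (intro mono_path_edge)
      have "\<not> mono_path A a b (s + 1)" using no_path True less.prems by blast
      then have sw: "s < w \<or> w + Q < s" using paths[of "s + 1"] by force
      let ?q = "if w = 1 \<and> w + Q < s then Q + 1 else 0"
      have q: "int ?q = (if int w = 1 \<and> int w + int Q < int s then int Q + 1 else 0)"
        by (simp flip: of_nat_add)
      have "g - ((int s)^2 + 2 * int s - 1) \<ge> int s * (int s - 1) - int s * int ?q"
        unfolding q using s sw Qle g by (intro close_face_arith) (auto simp: w_def)
      then have "?\<Gamma> a b \<ge> int s * (int s - 1) - int s * int ?q" using \<Gamma> True by simp
      moreover have "mono_path A a b l" if "1 \<le> l" "l \<le> 1 + ?q" for l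
        using edge paths[of l] that by (cases "l = 1") (auto split: if_splits)
      moreover have "int ?q \<le> int s - 1" using s by auto
      ultimately show ?thesis by (intro exI[of _ 0] exI[of _ ?q]) (auto simp del: of_nat_add)
    qed
  qed
qed

lemma polygon_bound:
  "((int s)^2 + 2 * int s - 1) * int (card (edges_between A 0 N)) \<le>
    (2 * int s - 1) * ((int s + 2) * int N - 1)"
proof -
  obtain Q where Q: "int Q \<le> int s - 1"
    "(2 * int s - 1) * ((int s + 2) * int N - 1) -
       ((int s)^2 + 2 * int s - 1) * int (card (edges_between A 0 N)) \<ge>
     int s * (int s - 1) - int s * int Q"
    using interval_bound[of 0 N] N last_side by auto
  have "int s * int Q \<le> int s * (int s - 1)" using Q(1) by (intro mult_left_mono) auto
  then show ?thesis using Q(2) by linarith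
qed

end

section \<open>Cycles and separations\<close>

lemma is_path_rev [simp]: "is_path E (rev xs) \<longleftrightarrow> is_path E xs"
  by (simp add: insert_commute)

text \<open>An edge counts as a cycle of length 2, so that extending cycles by ears can start from an edge.\<close>
definition is_cycle :: "'a set set \<Rightarrow> 'a list \<Rightarrow> bool" where
  "is_cycle E xs \<longleftrightarrow> length xs \<ge> 2 \<and> distinct xs \<and> is_path E xs \<and> {last xs, hd xs} \<in> E"

lemma is_cycle_rotate:
  assumes "is_cycle E (X @ Y)"
  shows "is_cycle E (Y @ X)"
proof (cases "X = [] \<or> Y = []")
  case True
  then show ?thesis using assms by auto
next
  case False
  then show ?thesis using assms by (auto simp: is_cycle_def successively_append_iff)
qed

text \<open>If both arcs of the cycle between \<open>c\<close> and \<open>d\<close> had inner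
  vertices, they would form a forbidden theta with the ear. So one arc has none, and the ear takes
  its place.\<close>

lemma is_cycle_ear:
  assumes E: "theta_free E" and xs: "is_cycle E xs"
    and cd: "c \<in> set xs" "d \<in> set xs" "c \<noteq> d"
    and es: "es \<noteq> []" "distinct es" "set es \<inter> set xs = {}" "is_path E (c # es @ [d])"
  shows "\<exists>ys. is_cycle E ys \<and> set ys = set xs \<union> set es \<and> length ys = length xs + length es"
proof -
  obtain U V where UV: "xs = U @ c # V" using cd(1) by (meson split_list)
  have cyc: "is_cycle E (c # V @ U)" using is_cycle_rotate[of E U "c # V"] xs UV by simp
  have "d \<in> set (V @ U)" using cd UV by auto
  then obtain Y Z where YZ: "V @ U = Y @ d # Z" by (meson split_list)
  note cyc = cyc[unfolded YZ]
  have set_xs: "set xs = insert c (insert d (set Y \<union> set Z))"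
    using arg_cong[OF YZ, of set] UV by auto
  have len: "length xs = length Y + length Z + 2"
    using arg_cong[OF YZ, of length] UV by simp
  have dist: "distinct (c # d # Y @ es @ rev Z)"
    using cyc es set_xs by (auto simp: is_cycle_def)
  have pY: "is_path E (c # Y @ [d])"
    using cyc by (auto simp: is_cycle_def successively_append_iff successively_Cons hd_append)
  have "is_path E ((d # Z) @ [c])"
    using cyc unfolding is_cycle_def successively_append_iff[of _ "d # Z"]
    by (auto simp: successively_append_iff successively_Cons)
  then have "is_path E (rev ((d # Z) @ [c]))" by (simp only: is_path_rev)
  then have pZ: "is_path E (c # rev Z @ [d])" by simp
  have "is_path E (rev (c # es @ [d]))" using es(4) by (simp only: is_path_rev)
  then have pe: "is_path E (d # rev es @ [c])" by simp
  consider "Y = []" | "Z = []" | "Y \<noteq> []" "Z \<noteq> []" by blast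
  then show ?thesis
  proof cases
    case 1
    have "is_path E (c # es @ d # Z)"
      using es(4) cyc successively_append_iff[of _ "c # es" "d # Z"] successively_append_iff[of _ "c # es" "[d]"]
      by (auto simp: is_cycle_def 1)
    then have "is_cycle E (c # es @ d # Z)"
      using cyc dist by (auto simp: is_cycle_def 1)
    then show ?thesis using set_xs len 1 by (intro exI[of _ "c # es @ d # Z"]) auto
  next
    case 2
    have "is_path E (d # rev es)" "{last (d # rev es), c} \<in> E"
      using pe successively_append_iff[of _ "d # rev es" "[c]"] by auto
    moreover have "is_path E (c # Y)" "{last (c # Y), d} \<in> E"
      using pY successively_append_iff[of _ "c # Y" "[d]"] by auto
    ultimately have "is_path E ((c # Y) @ (d # rev es))" "{last ((c # Y) @ (d # rev es)), c} \<in> E"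
      unfolding successively_append_iff by auto
    then have "is_cycle E (c # Y @ d # rev es)"
      using dist by (auto simp: is_cycle_def)
    then show ?thesis using set_xs len 2 by (intro exI[of _ "c # Y @ d # rev es"]) auto
  next
    case 3
    then have False
      using theta_freeD[OF E 3(1) es(1) _ dist pY es(4) pZ] by simp
    then show ?thesis ..
  qed
qed

text \<open>A vertex in \<open>A\<close> would give three paths with inner vertices from
  \<open>p\<close> to \<open>q\<close>: along \<open>A\<close>, over the chord \<open>{p, r}\<close>
  and back through \<open>B\<close>, and back through \<open>D\<close> and over the chord
  \<open>{q, s}\<close>.\<close>

lemma crossing_chords_adjacent:
  assumes E: "theta_free E" and cyc: "is_cycle E (p # A @ q # B @ r # C @ s # D)"
    and chords: "{p, r} \<in> E" "{q, s} \<in> E"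
  shows "A = []"
proof (rule ccontr)
  assume A: "A \<noteq> []"
  have "is_path E ((p # A) @ (q # B) @ (r # C) @ (s # D))"
    "{last ((p # A) @ (q # B) @ (r # C) @ (s # D)), p} \<in> E"
    using cyc by (simp_all add: is_cycle_def)
  then have parts: "is_path E (p # A)" "{last (p # A), q} \<in> E" "is_path E (q # B)"
    "{last (q # B), r} \<in> E" "is_path E (s # D)" "{last (s # D), p} \<in> E"
    unfolding successively_append_iff by simp_all
  have "is_path E ((p # A) @ [q])"
    using parts unfolding successively_append_iff by simp
  then have pA: "is_path E (p # A @ [q])" by simp
  have "is_path E ((q # B) @ [r])"
    using parts unfolding successively_append_iff by simp
  then have "is_path E (rev ((q # B) @ [r]))" by (simp only: is_path_rev)
  then have pB: "is_path E (p # (r # rev B) @ [q])" using chords by simp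
  have "is_path E ([q] @ (s # D) @ [p])"
    using parts chords unfolding successively_append_iff by simp
  then have "is_path E (rev ([q] @ (s # D) @ [p]))" by (simp only: is_path_rev)
  then have pD: "is_path E (p # (rev D @ [s]) @ [q])" by simp
  have "distinct (p # q # A @ (r # rev B) @ (rev D @ [s]))"
    using cyc by (auto simp: is_cycle_def)
  then show False by (rule theta_freeD[OF E A _ _ _ pA pB pD, rotated 2]) simp_all
qed

text \<open>Rotating the cycle empties all four gaps, and a 4-cycle with both diagonals is a
  \<open>K4\<close>.\<close>

lemma no_crossing_chords:
  assumes E: "theta_free E" "K4_free E" and cyc: "is_cycle E (p # A @ q # B @ r # C @ s # D)"
    and chords: "{p, r} \<in> E" "{q, s} \<in> E"
  shows False
proof -
  have sym: "{r, p} \<in> E" "{s, q} \<in> E" using chords by (simp_all add: insert_commute)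
  have cyc2: "is_cycle E (q # B @ r # C @ s # D @ p # A)"
    using is_cycle_rotate[of E "p # A" "q # B @ r # C @ s # D"] cyc by simp
  have cyc3: "is_cycle E (r # C @ s # D @ p # A @ q # B)"
    using is_cycle_rotate[of E "q # B" "r # C @ s # D @ p # A"] cyc2 by simp
  have cyc4: "is_cycle E (s # D @ p # A @ q # B @ r # C)"
    using is_cycle_rotate[of E "r # C" "s # D @ p # A @ q # B"] cyc3 by simp
  have "A = []" "B = []" "C = []" "D = []"
    using crossing_chords_adjacent[OF E(1)] cyc cyc2 cyc3 cyc4 chords sym by blast+
  then have "is_cycle E [p, q, r, s]" using cyc by simp
  then have *: "distinct [p, q, r, s]" "{{p, q}, {p, r}, {p, s}, {q, r}, {q, s}, {r, s}} \<subseteq> E"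
    using chords by (auto simp: is_cycle_def insert_commute)
  show False using E(2)[unfolded K4_free_def, rule_format, OF *(1)] *(2) by (rule notE)
qed

lemma drop_eq_append_nth:
  assumes "i \<le> j" "j < length xs"
  obtains ys where "drop i xs = ys @ xs ! j # drop (Suc j) xs"
proof -
  have "drop i xs = take (j - i) (drop i xs) @ drop i xs ! (j - i) # drop (Suc (j - i)) (drop i xs)"
    using assms by (intro id_take_nth_drop) simp
  moreover have "drop i xs ! (j - i) = xs ! j" "drop (Suc (j - i)) (drop i xs) = drop (Suc j) xs"
    using assms by simp_all
  ultimately show ?thesis using that by metis
qed

lemma rtrancl_imp_distinct_list:
  assumes "(x, y) \<in> r\<^sup>*"
  obtains xs where "xs \<noteq> []" "hd xs = x" "last xs = y" "distinct xs"
    "successively (\<lambda>u v. (u, v) \<in> r) xs" "set xs \<subseteq> r\<^sup>* `` {x}"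
proof -
  have "\<exists>xs. xs \<noteq> [] \<and> hd xs = x \<and> last xs = y \<and> distinct xs \<and>
    successively (\<lambda>u v. (u, v) \<in> r) xs \<and> set xs \<subseteq> r\<^sup>* `` {x}"
    using assms
  proof (induction rule: rtrancl_induct)
    case base
    show ?case by (intro exI[of _ "[x]"]) auto
  next
    case (step y z)
    then obtain xs where xs: "xs \<noteq> []" "hd xs = x" "last xs = y" "distinct xs"
      "successively (\<lambda>u v. (u, v) \<in> r) xs" "set xs \<subseteq> r\<^sup>* `` {x}" by blast
    show ?case
    proof (cases "z \<in> set xs")
      case True
      then obtain ys zs where "xs = ys @ z # zs" by (meson split_list)
      then have ys: "xs = (ys @ [z]) @ zs" by simp
      then have "successively (\<lambda>u v. (u, v) \<in> r) (ys @ [z])"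
        using xs(5) by (simp only: successively_append_iff)
      moreover have "hd (ys @ [z]) = x" using xs(2) ys by (cases ys) auto
      ultimately show ?thesis using xs ys by (intro exI[of _ "ys @ [z]"]) auto
    next
      case False
      then show ?thesis using xs step.hyps
        by (intro exI[of _ "xs @ [z]"]) (auto simp: successively_append_iff)
    qed
  qed
  then show ?thesis using that by blast
qed

text \<open>Let \<open>R\<close> be a component of the vertices of \<open>A\<close> off the cycle
  and \<open>T\<close> its neighbours on the cycle. Two vertices of \<open>T\<close> are joined by
  an ear through \<open>R\<close>; otherwise \<open>T\<close> separates \<open>R\<close> from the
  rest. This takes the place of a decomposition into blocks.\<close>

lemma cycle_extend_or_split:
  assumes E: "theta_free E" and xs: "is_cycle E xs" "set xs \<subset> A"
  shows "(\<exists>ys. is_cycle E ys \<and> set ys \<subseteq> A \<and> length xs < length ys) \<or>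
    (\<exists>A1 A2. A = A1 \<union> A2 \<and> A1 \<noteq> A \<and> A2 \<noteq> A \<and> (\<exists>c. A1 \<inter> A2 \<subseteq> {c}) \<and>
       (\<forall>x y. {x, y} \<in> E \<longrightarrow> {x, y} \<subseteq> A \<longrightarrow> {x, y} \<subseteq> A1 \<or> {x, y} \<subseteq> A2))"
proof -
  obtain v where v: "v \<in> A" "v \<notin> set xs" using xs(2) by blast
  define r where "r = {(x, y). {x, y} \<in> E \<and> x \<in> A - set xs \<and> y \<in> A - set xs}"
  define R where "R = r\<^sup>* `` {v}"
  have "sym r" by (auto simp: r_def sym_def insert_commute)
  then have sym: "sym (r\<^sup>*)" by (rule sym_rtrancl)
  have R_sub: "R \<subseteq> A - set xs"
  proof
    fix y assume "y \<in> R"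
    then have "(v, y) \<in> r\<^sup>*" by (simp add: R_def)
    then show "y \<in> A - set xs" using v by (induction rule: rtrancl_induct) (auto simp: r_def)
  qed
  have R_closed: "y \<in> R" if "x \<in> R" "{x, y} \<in> E" "y \<in> A - set xs" for x y
  proof -
    have "(x, y) \<in> r" using that R_sub by (auto simp: r_def)
    then show ?thesis using that(1) by (auto simp: R_def intro: rtrancl_into_rtrancl)
  qed
  have "v \<in> R" by (simp add: R_def)
  define T where "T = {c \<in> set xs. \<exists>x\<in>R. {x, c} \<in> E}"
  show ?thesis
  proof (cases "\<exists>c. T \<subseteq> {c}")
    case True
    have "length xs \<ge> 2" "distinct xs" using xs(1) by (auto simp: is_cycle_def)
    then have "card (set xs) \<ge> 2" by (simp add: distinct_card)
    then have "\<not> set xs \<subseteq> T" using True card_mono[of "{_}" "set xs"] by fastforce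
    then have "R \<union> T \<noteq> A" using R_sub xs(2) by blast
    moreover have "A - R \<noteq> A" using \<open>v \<in> R\<close> v by blast
    moreover have "A = (R \<union> T) \<union> (A - R)" using R_sub xs(2) by (auto simp: T_def)
    moreover have "\<exists>c. (R \<union> T) \<inter> (A - R) \<subseteq> {c}" using True by blast
    moreover have "{x, y} \<subseteq> R \<union> T \<or> {x, y} \<subseteq> A - R" if "{x, y} \<in> E" "{x, y} \<subseteq> A" for x y
    proof -
      have *: "b \<in> R \<union> T" if "a \<in> R" "{a, b} \<in> E" "b \<in> A" for a b
        using that R_closed[of a b] by (auto simp: T_def)
      show ?thesis using *[of x y] *[of y x] that by (auto simp: insert_commute)
    qed
    ultimately show ?thesis by blast
  next
    case False
    then obtain c d where cd: "c \<in> T" "d \<in> T" "c \<noteq> d" by blast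
    then obtain x y where xy: "x \<in> R" "{x, c} \<in> E" "y \<in> R" "{y, d} \<in> E"
      by (auto simp: T_def)
    have "(x, y) \<in> r\<^sup>*"
      using xy(1,3) sym unfolding R_def by (auto elim: symE intro: rtrancl_trans)
    then obtain es where es: "es \<noteq> []" "hd es = x" "last es = y" "distinct es"
      "successively (\<lambda>u v. (u, v) \<in> r) es" "set es \<subseteq> r\<^sup>* `` {x}"
      by (rule rtrancl_imp_distinct_list)
    have "set es \<subseteq> R" using es(6) xy(1) by (auto simp: R_def intro: rtrancl_trans)
    moreover have "is_path E es" using es(5) by (rule successively_mono) (simp add: r_def)
    then have "is_path E (c # es @ [d])"
      using es xy by (simp add: successively_append_iff successively_Cons insert_commute)
    ultimately obtain ys where "is_cycle E ys" "set ys = set xs \<union> set es"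
      "length ys = length xs + length es"
      using is_cycle_ear[OF E xs(1), of c d es] cd es R_sub by (auto simp: T_def)
    then show ?thesis using es(1) \<open>set es \<subseteq> R\<close> R_sub xs(2)
      by (intro disjI1 exI[of _ ys]) auto
  qed
qed

section \<open>The edge bound for graphs without thetas, \<open>K4\<close> and
  \<open>k\<close>-cycles\<close>

locale turan_graph =
  fixes E :: "'a set set" and k :: nat
  assumes k: "k \<ge> 3" and card_edge: "e \<in> E \<Longrightarrow> card e = 2"
    and theta_free: "theta_free E" and K4_free: "K4_free E"
    and no_cycle: "length xs = k \<Longrightarrow> \<not> is_cycle E xs"
begin

text \<open>This is \<open>polygon_bound\<close> for \<open>s = k - 2\<close>, with the vertices
  numbered along the cycle: then \<open>s^2 + 2 * s - 1 = k^2 - 2 * k - 1\<close> and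
  \<open>2 * s - 1 = 2 * k - 5\<close>.\<close>

lemma hamiltonian_bound:
  assumes xs: "is_cycle E xs"
  shows "((int k)^2 - 2 * int k - 1) * int (card {e \<in> E. e \<subseteq> set xs}) \<le>
    (2 * int k - 5) * (int k * (int (card (set xs)) - 1) - 1)"
proof -
  define N where "N = length xs - 1"
  define A where "A i j \<longleftrightarrow> {xs ! i, xs ! j} \<in> E" for i j
  have len: "length xs = Suc N" "N \<ge> 1" and dist: "distinct xs"
    using xs by (auto simp: is_cycle_def N_def)
  interpret noncrossing_polygon "k - 2" N A
  proof
    show "1 \<le> k - 2" "1 \<le> N" using k len by auto
    show "A i (Suc i)" if "i < N" for i
    proof -
      have "is_path E xs" using xs by (simp add: is_cycle_def)
      from successively_nth[OF this, of i] show ?thesis using that len by (simp add: A_def)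
    qed
    have "xs \<noteq> []" using len by auto
    then have "hd xs = xs ! 0" "last xs = xs ! N"
      using len by (simp_all add: hd_conv_nth last_conv_nth)
    then show "A 0 N"
      using xs by (simp add: is_cycle_def A_def insert_commute)
    show "\<not> A c d" if lt: "a < c" "c < b" "b < d" "d \<le> N" and ab: "A a b" for a b c d
    proof
      assume cd: "A c d"
      have le: "0 \<le> a" "Suc a \<le> c" "Suc c \<le> b" "Suc b \<le> d"
        and len': "a < length xs" "c < length xs" "b < length xs" "d < length xs"
        using lt len by simp_all
      obtain X where X: "drop 0 xs = X @ xs ! a # drop (Suc a) xs"
        by (rule drop_eq_append_nth[OF le(1) len'(1)])
      obtain B where B: "drop (Suc a) xs = B @ xs ! c # drop (Suc c) xs"
        by (rule drop_eq_append_nth[OF le(2) len'(2)])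
      obtain C where C: "drop (Suc c) xs = C @ xs ! b # drop (Suc b) xs"
        by (rule drop_eq_append_nth[OF le(3) len'(3)])
      obtain D where D: "drop (Suc b) xs = D @ xs ! d # drop (Suc d) xs"
        by (rule drop_eq_append_nth[OF le(4) len'(4)])
      have "xs = X @ xs ! a # B @ xs ! c # C @ xs ! b # D @ xs ! d # drop (Suc d) xs"
        using X unfolding B C D by simp
      from back_subst[of "is_cycle E", OF xs this]
      have "is_cycle E ((xs ! a # B @ xs ! c # C @ xs ! b # D @ xs ! d # drop (Suc d) xs) @ X)"
        by (rule is_cycle_rotate)
      then have "is_cycle E (xs ! a # B @ xs ! c # C @ xs ! b # D @ xs ! d # (drop (Suc d) xs @ X))"
        by simp
      from no_crossing_chords[OF theta_free K4_free this] show False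
        using ab cd by (simp add: A_def)
    qed
    show "\<not> mono_path A a b (k - 2 + 1)" if ab: "a < b" "b \<le> N" "A a b" for a b
    proof
      assume "mono_path A a b (k - 2 + 1)"
      moreover have "Suc (k - 2 + 1) = k" using k by simp
      ultimately obtain ix where ix: "length ix = k" "hd ix = a" "last ix = b"
        "sorted_wrt (<) ix" "successively A ix"
        unfolding mono_path_def by metis
      then have "ix \<noteq> []" using k by auto
      then obtain js where js: "ix = js @ [b]" using ix(3) by (metis append_butlast_last_id)
      have bd: "set ix \<subseteq> {..<length xs}"
        using ix(4) ab len by (force simp: js sorted_wrt_append)
      have "inj_on ((!) xs) (set ix)" using bd dist by (intro inj_on_nth) auto
      then have "distinct (map ((!) xs) ix)"
        using ix(4) by (simp add: distinct_map strict_sorted_iff)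
      moreover have "is_path E (map ((!) xs) ix)"
        using ix(5) by (simp add: successively_map A_def)
      moreover have "hd (map ((!) xs) ix) = xs ! a" "last (map ((!) xs) ix) = xs ! b"
        using ix \<open>ix \<noteq> []\<close> by (simp_all add: hd_map last_map)
      moreover have "{xs ! b, xs ! a} \<in> E"
        using ab(3) by (simp add: A_def insert_commute)
      ultimately have "is_cycle E (map ((!) xs) ix)"
        using ix(1) k unfolding is_cycle_def by simp
      then show False using no_cycle ix(1) by simp
    qed
  qed
  have "bij_betw (\<lambda>(i, j). {xs ! i, xs ! j}) (edges_between A 0 N) {e \<in> E. e \<subseteq> set xs}"
  proof (rule bij_betwI')
    fix u v assume "u \<in> edges_between A 0 N" "v \<in> edges_between A 0 N"
    then show "((\<lambda>(i, j). {xs ! i, xs ! j}) u = (\<lambda>(i, j). {xs ! i, xs ! j}) v) = (u = v)"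
      using dist len by (auto simp: edges_between_def doubleton_eq_iff nth_eq_iff_index_eq)
  next
    fix u assume "u \<in> edges_between A 0 N"
    then show "(\<lambda>(i, j). {xs ! i, xs ! j}) u \<in> {e \<in> E. e \<subseteq> set xs}"
      using len by (auto simp: edges_between_def A_def)
  next
    fix e assume e: "e \<in> {e \<in> E. e \<subseteq> set xs}"
    then obtain x y where xy: "e = {x, y}" "x \<noteq> y"
      using card_edge[of e] unfolding card_2_iff by blast
    then obtain i j where ij: "i < length xs" "j < length xs" "x = xs ! i" "y = xs ! j"
      using e by (auto simp: in_set_conv_nth)
    then have "i \<noteq> j" using xy by auto
    then show "\<exists>u\<in>edges_between A 0 N. e = (\<lambda>(i, j). {xs ! i, xs ! j}) u"
      using e xy ij len
      by (intro bexI[of _ "(min i j, max i j)"])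
        (auto simp: edges_between_def A_def min_def max_def insert_commute)
  qed
  then have "card (edges_between A 0 N) = card {e \<in> E. e \<subseteq> set xs}"
    by (rule bij_betw_same_card)
  moreover have "int (k - 2) = int k - 2" using k by simp
  moreover have "card (set xs) = Suc N" using distinct_card[OF dist] len by simp
  ultimately show ?thesis
    using polygon_bound by (simp add: algebra_simps power2_eq_square)
qed

text \<open>\<open>E\<close> stays fixed while \<open>A\<close> shrinks, so the hypotheses on
  \<open>E\<close> survive the induction. The correction by 1 is dropped for a single vertex, where
  the bound has to be 0.\<close>

theorem edge_bound:
  assumes "finite A" "A \<noteq> {}"
  shows "((int k)^2 - 2 * int k - 1) * int (card {e \<in> E. e \<subseteq> A}) \<le>
    (2 * int k - 5) * (int k * (int (card A) - 1) - (if card A \<ge> 2 then 1 else 0))"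
  using assms
proof (induction "card A" arbitrary: A rule: less_induct)
  case less
  let ?M = "(int k)^2 - 2 * int k - 1"
  have M: "?M \<ge> 0"
  proof -
    have "int k * 3 \<le> int k * int k" using k by (intro mult_left_mono) auto
    then show ?thesis using k by (simp add: power2_eq_square)
  qed
  have fin: "finite {e \<in> E. e \<subseteq> B}" if "finite B" for B
    using that by simp
  show ?case
  proof (cases "{e \<in> E. e \<subseteq> A} = {}")
    case True
    have "card A \<ge> 1" using less.prems by (simp add: Suc_le_eq card_gt_0_iff)
    then have "0 \<le> int k * (int (card A) - 1) - (if card A \<ge> 2 then 1 else 0)"
      using k mult_mono[of 1 "int k" 1 "int (card A) - 1"] by auto
    then have "0 \<le> (2 * int k - 5) * (int k * (int (card A) - 1) - (if card A \<ge> 2 then 1 else 0))"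
      using k by (intro mult_nonneg_nonneg) auto
    then show ?thesis unfolding True by simp
  next
    case False
    then obtain e where e: "e \<in> E" "e \<subseteq> A" by blast
    then have cA: "card A \<ge> 2" using card_edge card_mono[OF less.prems(1) e(2)] by auto
    obtain u v where "e = {u, v}" "u \<noteq> v" using card_edge[OF e(1)] unfolding card_2_iff by blast
    then have "is_cycle E [u, v] \<and> set [u, v] \<subseteq> A"
      using e by (auto simp: is_cycle_def insert_commute)
    moreover have "length ys < card A + 1" if "is_cycle E ys \<and> set ys \<subseteq> A" for ys
      using that card_mono[OF less.prems(1), of "set ys"] by (simp add: is_cycle_def distinct_card)
    ultimately obtain xs where "is_cycle E xs \<and> set xs \<subseteq> A"
      and "\<forall>ys. is_cycle E ys \<and> set ys \<subseteq> A \<longrightarrow> length ys \<le> length xs"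
      using ex_has_greatest_nat[of "\<lambda>ys. is_cycle E ys \<and> set ys \<subseteq> A" "[u, v]" length "card A + 1"]
      by blast
    then have xs: "is_cycle E xs" "set xs \<subseteq> A"
      and longest: "\<not> (\<exists>ys. is_cycle E ys \<and> set ys \<subseteq> A \<and> length xs < length ys)"
      by (auto simp: not_less)
    show ?thesis
    proof (cases "set xs = A")
      case True
      then show ?thesis using hamiltonian_bound[OF xs(1)] cA by simp
    next
      case False
      then have "set xs \<subset> A" using xs(2) by blast
      from cycle_extend_or_split[OF theta_free xs(1) this] longest
      obtain A1 A2 c where A12: "A = A1 \<union> A2" "A1 \<noteq> A" "A2 \<noteq> A" "A1 \<inter> A2 \<subseteq> {c}"
        and edges: "\<And>x y. {x, y} \<in> E \<Longrightarrow> {x, y} \<subseteq> A \<Longrightarrow> {x, y} \<subseteq> A1 \<or> {x, y} \<subseteq> A2"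
        by blast
      have fin12: "finite A1" "finite A2" using less.prems A12(1) by auto
      have ne: "A1 \<noteq> {}" "A2 \<noteq> {}" using A12 by auto
      have lt: "card A1 < card A" "card A2 < card A"
        using A12 less.prems by (auto intro!: psubset_card_mono)
      note IH = less.hyps[OF lt(1) fin12(1) ne(1)] less.hyps[OF lt(2) fin12(2) ne(2)]
      have "{e \<in> E. e \<subseteq> A} \<subseteq> {e \<in> E. e \<subseteq> A1} \<union> {e \<in> E. e \<subseteq> A2}"
      proof
        fix e assume e: "e \<in> {e \<in> E. e \<subseteq> A}"
        then obtain x y where "e = {x, y}" using card_edge[of e] unfolding card_2_iff by blast
        then show "e \<in> {e \<in> E. e \<subseteq> A1} \<union> {e \<in> E. e \<subseteq> A2}" using edges[of x y] e by auto
      qed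
      then have "card {e \<in> E. e \<subseteq> A} \<le> card {e \<in> E. e \<subseteq> A1} + card {e \<in> E. e \<subseteq> A2}"
        using fin fin12 by (meson card_Un_le card_mono finite_UnI le_trans)
      then have "int (card {e \<in> E. e \<subseteq> A}) \<le> int (card {e \<in> E. e \<subseteq> A1}) + int (card {e \<in> E. e \<subseteq> A2})"
        by linarith
      from mult_left_mono[OF this M]
      have le: "?M * int (card {e \<in> E. e \<subseteq> A}) \<le>
          ?M * int (card {e \<in> E. e \<subseteq> A1}) + ?M * int (card {e \<in> E. e \<subseteq> A2})"
        by (simp only: distrib_left)
      have card: "card A + card (A1 \<inter> A2) = card A1 + card A2"
        using card_Un_Int[OF fin12] A12(1) by simp
      have c1: "card A1 \<ge> 1" "card A2 \<ge> 1" using ne fin12 by (simp_all add: Suc_le_eq card_gt_0_iff)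
      have cI: "card (A1 \<inter> A2) \<le> 1" using A12(4) card_mono[of "{c}" "A1 \<inter> A2"] by simp
      \<comment> \<open>\<open>?f\<close> is superadditive over splits: a disjoint split leaves a
        surplus of \<open>k\<close>, and at a cut vertex both parts have at least two vertices, so
        two corrections stand against one.\<close>
      let ?f = "\<lambda>B. int k * (int (card B) - 1) - (if card B \<ge> 2 then 1 else 0)"
      have "?f A1 + ?f A2 \<le> ?f A"
      proof (cases "card (A1 \<inter> A2) = 0")
        case True
        then have eq: "int (card A) = int (card A1) + int (card A2)" using card by linarith
        have "?f A1 + ?f A2 \<le> int k * (int (card A1) - 1) + int k * (int (card A2) - 1)"
          by simp
        also have "\<dots> \<le> int k * (int (card A) - 1) - 1"
          unfolding eq using k by (simp add: algebra_simps)
        finally show ?thesis using cA by simp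
      next
        case False
        then have eq: "int (card A) = int (card A1) + int (card A2) - 1" using card cI by linarith
        then have "card A1 \<ge> 2" "card A2 \<ge> 2" using lt by linarith+
        then have "?f A1 + ?f A2 \<le> int k * (int (card A1) - 1) + int k * (int (card A2) - 1) - 1"
          by simp
        also have "\<dots> = int k * (int (card A) - 1) - 1"
          unfolding eq by (simp add: algebra_simps)
        finally show ?thesis using cA by simp
      qed
      then have "(2 * int k - 5) * (?f A1 + ?f A2) \<le> (2 * int k - 5) * ?f A"
        using k by (intro mult_left_mono) auto
      then show ?thesis using IH le by (simp only: distrib_left)
    qed
  qed
qed

end

section \<open>Drawings on a parabola\<close>

definition noncrossing_edges :: "nat set set \<Rightarrow> bool" where
  "noncrossing_edges E \<longleftrightarrow>
     (\<forall>a b c d. a < c \<and> c < b \<and> b < d \<longrightarrow> {a, b} \<in> E \<longrightarrow> {c, d} \<notin> E)"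

text \<open>Points in convex position in the order of their numbers: two chords cross exactly when
  their ends interleave.\<close>

definition parabola_point :: "nat \<Rightarrow> complex" where
  "parabola_point i = Complex (real i) ((real i)\<^sup>2)"

lemma parabola_point_simps [simp]:
  "Re (parabola_point i) = real i" "Im (parabola_point i) = (real i)\<^sup>2"
  by (simp_all add: parabola_point_def)

lemma parabola_chord:
  assumes "z \<in> closed_segment (parabola_point a) (parabola_point b)" "a < b"
  shows "real a \<le> Re z" "Re z \<le> real b" "Im z = (real a + real b) * Re z - real a * real b"
proof -
  obtain u where u: "0 \<le> u" "u \<le> 1"
    and z: "z = (1 - u) *\<^sub>R parabola_point a + u *\<^sub>R parabola_point b"
    using assms(1) by (auto simp: in_segment)
  have Re: "Re z = real a + u * (real b - real a)" unfolding z by (simp add: algebra_simps)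
  have "u * (real b - real a) \<le> real b - real a"
    using u assms(2) mult_right_mono[of u 1 "real b - real a"] by simp
  moreover have "0 \<le> u * (real b - real a)" using u assms(2) by simp
  ultimately show "real a \<le> Re z" "Re z \<le> real b" unfolding Re by linarith+
  show "Im z = (real a + real b) * Re z - real a * real b"
    unfolding z by (simp add: algebra_simps power2_eq_square)
qed

lemma parabola_point_eqI: "Re z = real i \<Longrightarrow> Im z = (real i)\<^sup>2 \<Longrightarrow> z = parabola_point i"
  by (simp add: complex_eq_iff)

lemma parabola_point_on_chord:
  assumes "parabola_point c \<in> closed_segment (parabola_point a) (parabola_point b)" "a < b"
  shows "c = a \<or> c = b"
proof -
  have "(real c - real a) * (real c - real b) = 0"
    using parabola_chord(3)[OF assms] by (simp add: algebra_simps power2_eq_square)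
  then show ?thesis by simp
qed

text \<open>At abscissa \<open>x\<close> the chord from \<open>a\<close> to \<open>b\<close> is
  \<open>(x - a) * (b - x)\<close> above the parabola. Of two chords over nested intervals, the
  outer one is strictly higher in the interior of the inner interval.\<close>

lemma parabola_chords_Int:
  assumes ab: "a < b" and cd: "c < d" and ne: "(a, b) \<noteq> (c, d)"
    and nc: "\<not> (a < c \<and> c < b \<and> b < d)" "\<not> (c < a \<and> a < d \<and> d < b)"
    and z1: "z \<in> closed_segment (parabola_point a) (parabola_point b)"
    and z2: "z \<in> closed_segment (parabola_point c) (parabola_point d)"
  shows "z \<in> parabola_point ` {a, b} \<inter> parabola_point ` {c, d}"
proof -
  note 1 = parabola_chord[OF z1 ab] and 2 = parabola_chord[OF z2 cd]
  define x where "x = Re z"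
  have x: "real a \<le> x" "x \<le> real b" "real c \<le> x" "x \<le> real d" using 1 2 by (auto simp: x_def)
  have eq: "(x - real a) * (real b - x) = (x - real c) * (real d - x)"
    using 1(3) 2(3) by (simp add: x_def algebra_simps)
  have at: "z = parabola_point i" if "x = real i" "i = a \<or> i = b" for i
    using that 1(3) by (intro parabola_point_eqI) (auto simp: x_def algebra_simps power2_eq_square)
  have key: "x = real c \<or> x = real d"
    if "real a \<le> real c" "real d \<le> real b" "(a, b) \<noteq> (c, d)"
      "(x - real a) * (real b - x) = (x - real c) * (real d - x)"
      "real c \<le> x" "x \<le> real d" for a b c d :: nat
  proof (rule ccontr)
    assume "\<not> ?thesis"
    then have *: "real c < x" "x < real d" using that by auto
    have "a < c \<or> d < b" using that by auto
    then have "(x - real c) * (real d - x) < (x - real a) * (real b - x)"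
    proof
      assume "a < c"
      then have "(x - real c) * (real d - x) < (x - real a) * (real d - x)"
        using * by (intro mult_strict_right_mono) auto
      also have "\<dots> \<le> (x - real a) * (real b - x)"
        using * that by (intro mult_left_mono) auto
      finally show ?thesis .
    next
      assume "d < b"
      then have "(x - real c) * (real d - x) < (x - real c) * (real b - x)"
        using * by (intro mult_strict_left_mono) auto
      also have "\<dots> \<le> (x - real a) * (real b - x)"
        using * that by (intro mult_right_mono) auto
      finally show ?thesis .
    qed
    then show False using that(4) by simp
  qed
  consider "b \<le> c" | "d \<le> a" | "a \<le> c" "d \<le> b" | "c \<le> a" "b \<le> d"
    using nc by linarith
  then show ?thesis
  proof cases
    case 1
    then have "x = real b" "b = c" using x by auto
    then show ?thesis using at[of b] by auto
  next
    case 2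
    then have "x = real a" "a = d" using x by auto
    then show ?thesis using at[of a] by auto
  next
    case 3
    then have "x = real c \<or> x = real d" using key[of a c d b] ne eq x by auto
    then show ?thesis
    proof
      assume c: "x = real c"
      then have "c = a \<or> c = b" using eq by auto
      then show ?thesis using at[of c] c by auto
    next
      assume d: "x = real d"
      then have "d = a \<or> d = b" using eq by auto
      then show ?thesis using at[of d] d by auto
    qed
  next
    case 4
    then have "x = real a \<or> x = real b" using key[of c a b d] ne eq x by auto
    then show ?thesis
    proof
      assume a: "x = real a"
      then have "a = c \<or> a = d" using eq by auto
      then show ?thesis using at[of a] a by auto
    next
      assume b: "x = real b"
      then have "b = c \<or> b = d" using eq by auto
      then show ?thesis using at[of b] b by auto
    qed
  qed
qed

lemma convex_above_parabola: "convex {z. (Re z)\<^sup>2 \<le> Im z}"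
proof (rule convexI)
  fix x y :: complex and u v :: real
  assume xy: "x \<in> {z. (Re z)\<^sup>2 \<le> Im z}" "y \<in> {z. (Re z)\<^sup>2 \<le> Im z}"
    and uv: "0 \<le> u" "0 \<le> v" "u + v = 1"
  have "u * (Re x)\<^sup>2 + v * (Re y)\<^sup>2 - (u * Re x + v * Re y)\<^sup>2 = u * v * (Re x - Re y)\<^sup>2"
  proof -
    have v: "v = 1 - u" using uv by simp
    show ?thesis unfolding v by (simp add: algebra_simps power2_eq_square)
  qed
  moreover have "0 \<le> u * v * (Re x - Re y)\<^sup>2" using uv by simp
  moreover have "u * (Re x)\<^sup>2 \<le> u * Im x" "v * (Re y)\<^sup>2 \<le> v * Im y"
    using xy uv by (auto intro: mult_left_mono)
  ultimately show "u *\<^sub>R x + v *\<^sub>R y \<in> {z. (Re z)\<^sup>2 \<le> Im z}" by simp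
qed

text \<open>The drawing lies in the convex region above the parabola. The complement of that region
  belongs to the outer face and approaches every vertex from below.\<close>

lemma outerplanar_if_noncrossing:
  fixes G :: "nat ugraph"
  assumes G: "simple_graph G" and nc: "noncrossing_edges (edges G)"
  shows "outerplanar G"
proof -
  define \<gamma> where "\<gamma> e = linepath (parabola_point (Min e)) (parabola_point (Max e))" for e
  let ?P = "{z. (Re z)\<^sup>2 \<le> Im z}"
  let ?D = "drawing_points G parabola_point \<gamma>"
  have edge: "\<exists>a b. a < b \<and> e = {a, b} \<and> a \<in> vertices G \<and> b \<in> vertices G \<and>
      \<gamma> e = linepath (parabola_point a) (parabola_point b)" if "e \<in> edges G" for e
  proof -
    have "card e = 2" "e \<subseteq> vertices G" using G that by (auto simp: simple_graph_def)
    then obtain x y where "e = {x, y}" "x \<noteq> y" by (auto simp: card_2_iff)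
    then obtain a b where ab: "a < b" "e = {a, b}"
      by (metis insert_commute linorder_neqE_nat)
    then have "Min e = a" "Max e = b" by auto
    then show ?thesis using ab \<open>e \<subseteq> vertices G\<close> by (auto simp: \<gamma>_def)
  qed
  have inj: "inj parabola_point" by (rule injI) (simp add: complex_eq_iff)
  have pP: "parabola_point i \<in> ?P" for i by simp
  have "planar_drawing G parabola_point \<gamma>"
    unfolding planar_drawing_def
  proof (intro conjI ballI impI)
    show "inj_on parabola_point (vertices G)" using inj inj_on_subset by blast
    fix e assume "e \<in> edges G"
    then obtain a b where ab: "a < b" "e = {a, b}" "a \<in> vertices G" "b \<in> vertices G"
      "\<gamma> e = linepath (parabola_point a) (parabola_point b)" using edge by blast
    show "arc (\<gamma> e)" using ab inj by (auto intro!: arc_linepath dest: injD)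
    show "{pathstart (\<gamma> e), pathfinish (\<gamma> e)} = parabola_point ` e" using ab by simp
    show "path_image (\<gamma> e) \<inter> parabola_point ` vertices G = parabola_point ` e"
      using ab parabola_point_on_chord[of _ a b] by auto
    fix f assume "f \<in> edges G" "e \<noteq> f"
    then obtain c d where cd: "c < d" "f = {c, d}"
      "\<gamma> f = linepath (parabola_point c) (parabola_point d)" using edge by blast
    have "\<not> (a < c \<and> c < b \<and> b < d)" "\<not> (c < a \<and> a < d \<and> d < b)"
      using nc \<open>e \<in> edges G\<close> \<open>f \<in> edges G\<close> unfolding noncrossing_edges_def ab(2) cd(2) by blast+
    then show "path_image (\<gamma> e) \<inter> path_image (\<gamma> f) \<subseteq> parabola_point ` e \<inter> parabola_point ` f"
      using parabola_chords_Int[of a b c d] ab(1,2) cd(1,2) \<open>e \<noteq> f\<close>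
      unfolding ab(5) cd(3) path_image_linepath by blast
  qed
  moreover have "parabola_point v \<in> frontier (outside ?D)" if v: "v \<in> vertices G" for v
  proof -
    have "path_image (\<gamma> e) \<subseteq> ?P" if e: "e \<in> edges G" for e
    proof -
      obtain a b where "\<gamma> e = linepath (parabola_point a) (parabola_point b)"
        using edge[OF e] by blast
      then show ?thesis using closed_segment_subset[OF pP pP convex_above_parabola] by simp
    qed
    then have "?D \<subseteq> ?P" using pP by (auto simp: drawing_points_def)
    then have sub: "- ?P \<subseteq> outside ?D"
      using outside_mono[of ?D ?P] outside_convex[OF convex_above_parabola] by simp
    have "parabola_point v \<in> closure (- ?P)"
      unfolding closure_approachable
    proof (intro allI impI)
      fix e :: real assume "e > 0"
      then have "dist (parabola_point v - \<i> * of_real (e / 2)) (parabola_point v) < e"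
        by (simp add: dist_norm norm_mult)
      moreover have "parabola_point v - \<i> * of_real (e / 2) \<in> - ?P" using \<open>e > 0\<close> by simp
      ultimately show "\<exists>y\<in>- ?P. dist y (parabola_point v) < e" by blast
    qed
    then have "parabola_point v \<in> closure (outside ?D)" using closure_mono[OF sub] by blast
    moreover have "parabola_point v \<notin> outside ?D"
      using v by (auto simp: outside_def drawing_points_def)
    ultimately show ?thesis using interior_subset by (auto simp: frontier_def)
  qed
  ultimately show ?thesis unfolding outerplanar_def by blast
qed

section \<open>Cycles in noncrossing graphs\<close>

text \<open>To change sides without visiting \<open>lo\<close> or \<open>hi\<close>, the chain would
  need an edge that crosses \<open>{lo, hi}\<close>.\<close>

lemma chain_on_one_side:
  fixes g :: "nat \<Rightarrow> nat"
  assumes nc: "noncrossing_edges E" and lh: "{lo, hi} \<in> E" "lo < hi"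
    and chain: "\<And>j. m \<le> j \<Longrightarrow> Suc j < l \<Longrightarrow> {g j, g (Suc j)} \<in> E"
    and ne: "\<And>j. m \<le> j \<Longrightarrow> j < l \<Longrightarrow> g j \<noteq> lo \<and> g j \<noteq> hi"
    and j: "m \<le> j" "j < l"
  shows "(lo < g j \<and> g j < hi) = (lo < g m \<and> g m < hi)"
  using j
proof (induction j rule: dec_induct)
  case base
  show ?case ..
next
  case (step j)
  have e: "{g j, g (Suc j)} \<in> E" "{g (Suc j), g j} \<in> E"
    using chain[of j] step by (auto simp: insert_commute)
  have out: False if "x < lo \<or> hi < x" "lo < y" "y < hi" "{x, y} \<in> E" for x y
  proof -
    have "{y, x} \<in> E" using that(4) by (simp add: insert_commute)
    then show ?thesis using nc lh that unfolding noncrossing_edges_def by blast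
  qed
  have "g j \<noteq> lo" "g j \<noteq> hi" "g (Suc j) \<noteq> lo" "g (Suc j) \<noteq> hi"
    using ne[of j] ne[of "Suc j"] step by auto
  then have "(lo < g (Suc j) \<and> g (Suc j) < hi) = (lo < g j \<and> g j < hi)"
    using out[of "g j" "g (Suc j)"] out[of "g (Suc j)" "g j"] e by (meson linorder_neqE_nat)
  then show ?case using step by simp
qed

text \<open>A closed polygon with vertices in convex position whose sides do not cross visits its
  vertices in cyclic order: each side leaves all other vertices on one of its sides.\<close>
lemma noncrossing_cycle:
  fixes f :: "nat \<Rightarrow> nat"
  assumes nc: "noncrossing_edges E" and k: "k \<ge> 3" and inj: "inj_on f {..<k}"
    and edge: "\<And>i. i < k \<Longrightarrow> {f i, f (Suc i mod k)} \<in> E"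
  defines "S \<equiv> f ` {..<k}"
  shows "{Min S, Max S} \<in> E"
    and "\<And>a b. a \<in> S \<Longrightarrow> b \<in> S \<Longrightarrow> a < b \<Longrightarrow> S \<inter> {a<..<b} = {} \<Longrightarrow> {a, b} \<in> E"
proof -
  \<comment> \<open>\<open>P x y\<close>: the edge leaves the rest of \<open>S\<close> on one side.
    Both cycle neighbours of a vertex have this property, and so few vertices can have it that the
    neighbours are identified by it.\<close>
  define P where "P x y \<longleftrightarrow> {x, y} \<in> E \<and>
    ((\<forall>z\<in>S - {x, y}. min x y < z \<and> z < max x y) \<or> (\<forall>z\<in>S - {x, y}. \<not> (min x y < z \<and> z < max x y)))" for x y
  have fin: "finite S" by (simp add: S_def)
  have card: "card S = k" using inj by (simp add: S_def card_image)
  have nbrs: "\<exists>y1 y2. y1 \<in> S \<and> y2 \<in> S \<and> y1 \<noteq> x \<and> y2 \<noteq> x \<and> y1 \<noteq> y2 \<and> P x y1 \<and> P x y2"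
    if x: "x \<in> S" for x
  proof -
    obtain i where i: "i < k" "x = f i" using x by (auto simp: S_def)
    \<comment> \<open>Rotation puts \<open>x\<close> at position 0. The vertices other than
      \<open>x\<close> and one of its cycle neighbours then occupy consecutive positions, 2 to
      \<open>k - 1\<close> or 1 to \<open>k - 2\<close>.\<close>
    define h where "h j = (i + j) mod k" for j
    define g where "g j = f (h j)" for j
    have hk: "h j < k" for j using k by (simp add: h_def)
    have h_eq: "a = b" if "a \<le> b" "b < k" "h a = h b" for a b
    proof -
      have "k dvd (i + b) - (i + a)"
        using that mod_eq_dvd_iff_nat[of "i + a" "i + b" k] by (simp add: h_def)
      then have "k dvd b - a" by simp
      then show ?thesis using that nat_dvd_not_less[of "b - a" k] by linarith
    qed
    have inj_g: "inj_on g {..<k}"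
    proof (rule inj_onI)
      fix a b assume "a \<in> {..<k}" "b \<in> {..<k}" "g a = g b"
      moreover from this have "h a = h b"
        using inj_onD[OF inj, of "h a" "h b"] hk by (simp add: g_def)
      ultimately show "a = b"
        using h_eq[of a b] h_eq[of b a] by (metis lessThan_iff nat_le_linear)
    qed
    have gS: "g ` {..<k} = S"
    proof (rule card_subset_eq[OF fin])
      show "g ` {..<k} \<subseteq> S" using hk by (auto simp: g_def S_def)
      show "card (g ` {..<k}) = card S" using inj_g card by (simp add: card_image)
    qed
    have ge: "{g j, g (Suc j)} \<in> E" for j
      using edge[OF hk[of j]] by (simp add: g_def h_def mod_Suc_eq)
    have g0: "g 0 = x" using i by (simp add: g_def h_def)
    have gk: "g k = x" using i by (simp add: g_def h_def)
    have ginj: "g a \<noteq> g b" if "a < k" "b < k" "a \<noteq> b" for a b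
      using inj_g that by (auto simp: inj_on_def)
    have side: "P x y" if y: "y = g m0" "m0 < k" "m0 \<noteq> 0" "{x, y} \<in> E"
      and ml: "{m..<l} = {..<k} - {0, m0}" "l \<le> k" for y m0 m l
    proof -
      have ne: "g j \<noteq> x \<and> g j \<noteq> y" if "m \<le> j" "j < l" for j
      proof -
        have "j \<in> {..<k} - {0, m0}" using ml(1) that by (metis atLeastLessThan_iff)
        then show ?thesis using ginj[of j 0] ginj[of j m0] g0 y k by auto
      qed
      have xy: "x \<noteq> y" using ginj[of 0 m0] y g0 by auto
      have "{min x y, max x y} \<in> E" "min x y < max x y"
        using y(4) xy by (auto simp: min_def max_def insert_commute)
      then have *: "(min x y < g j \<and> g j < max x y) = (min x y < g m \<and> g m < max x y)"
        if "m \<le> j" "j < l" for j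
        using that ne ge by (intro chain_on_one_side[OF nc, where l = l]) (auto simp: min_def max_def)
      have all: "(min x y < z \<and> z < max x y) = (min x y < g m \<and> g m < max x y)" if z: "z \<in> S - {x, y}" for z
      proof -
        obtain j where j: "j < k" "z = g j" using z gS by blast
        have "g j \<noteq> g 0" "g j \<noteq> g m0" using z j(2) g0 y(1) by auto
        then have "j \<noteq> 0" "j \<noteq> m0" by metis+
        then have "j \<in> {m..<l}" unfolding ml(1) using j by simp
        then show ?thesis using *[of j] j by simp
      qed
      show ?thesis
      proof (cases "min x y < g m \<and> g m < max x y")
        case True
        then have "\<forall>z\<in>S - {x, y}. min x y < z \<and> z < max x y" using all by blast
        then show ?thesis unfolding P_def using y(4) by blast
      next
        case False
        then have "\<forall>z\<in>S - {x, y}. \<not> (min x y < z \<and> z < max x y)" using all by blast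
        then show ?thesis unfolding P_def using y(4) by blast
      qed
    qed
    have "P x (g 1)"
      using k ge[of 0] g0 by (intro side[of _ 1 2 k]) auto
    moreover have "P x (g (k - 1))"
    proof -
      have "{g (k - 1), g (Suc (k - 1))} \<in> E" by (rule ge)
      then show ?thesis
        using k gk by (intro side[of _ "k - 1" 1 "k - 1"]) (auto simp: insert_commute)
    qed
    moreover have "g 1 \<in> S" "g (k - 1) \<in> S" using gS k by auto
    moreover have "g 1 \<noteq> x" "g (k - 1) \<noteq> x" "g 1 \<noteq> g (k - 1)"
      using ginj[of 1 0] ginj[of "k - 1" 0] ginj[of 1 "k - 1"] k g0 by auto
    ultimately show ?thesis by blast
  qed
  have P_iff: "(min x y < z \<and> z < max x y) = (min x y < z' \<and> z' < max x y)"
    if "P x y" "z \<in> S" "z' \<in> S" "z \<noteq> x" "z \<noteq> y" "z' \<noteq> x" "z' \<noteq> y" for x y z z'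
    using that unfolding P_def by blast
  have ne: "S \<noteq> {}" using card k by auto
  define m M where "m = Min S" and "M = Max S"
  have m: "m \<in> S" "\<And>x. x \<in> S \<Longrightarrow> m \<le> x" and M: "M \<in> S" "\<And>x. x \<in> S \<Longrightarrow> x \<le> M"
    using fin ne by (auto simp: m_def M_def)
  have min_case: "{m, b} \<in> E \<and> {m, M} \<in> E"
    if b: "b \<in> S" "m < b" "S \<inter> {m<..<b} = {}" for b
  proof -
    \<comment> \<open>An edge from the least vertex to any other \<open>y\<close> would separate
      \<open>b\<close> from \<open>M\<close>. So two candidates remain for two neighbours.\<close>
    have *: "y = b \<or> y = M" if y: "y \<in> S" "y \<noteq> m" "P m y" for y
    proof (rule ccontr)
      assume "\<not> ?thesis"
      then have "m < b" "b < y" "y < M" "m < y"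
        using b y m(2)[of y] M(2)[of y] by (auto simp: not_less le_less)
      then show False using P_iff[OF y(3) b(1) M(1)] by simp
    qed
    obtain y1 y2 where y: "y1 \<in> S" "y2 \<in> S" "y1 \<noteq> m" "y2 \<noteq> m" "y1 \<noteq> y2" "P m y1" "P m y2"
      using nbrs[OF m(1)] by blast
    then have "P m b \<and> P m M" using *[of y1] *[of y2] by metis
    then show ?thesis by (simp add: P_def)
  qed
  show "{Min S, Max S} \<in> E"
  proof -
    define b where "b = Min (S - {m})"
    have "S - {m} \<noteq> {}"
    proof
      assume "S - {m} = {}"
      then have "card S \<le> 1" using m(1) by (metis card.empty card_Diff_singleton diff_is_0_eq fin)
      then show False using card k by simp
    qed
    then have "b \<in> S - {m}" "\<And>x. x \<in> S - {m} \<Longrightarrow> b \<le> x"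
      using fin Min_in[of "S - {m}"] Min_le[of "S - {m}"] unfolding b_def by blast+
    then show ?thesis using min_case[of b] m(2)[of b] unfolding m_def M_def by fastforce
  qed
  fix a b assume ab: "a \<in> S" "b \<in> S" "a < b" "S \<inter> {a<..<b} = {}"
  show "{a, b} \<in> E"
  proof (cases "a = m")
    case True
    then show ?thesis using min_case[of b] ab by blast
  next
    case False
    then have ma: "m < a" using m(2)[OF ab(1)] by simp
    have right: "y = b" if y: "y \<in> S" "a < y" "P a y" for y
    proof (rule ccontr)
      assume "y \<noteq> b"
      then have "b < y" using y ab(4) by (auto simp: not_less le_less)
      then show False using P_iff[OF y(3) ab(2) m(1)] ma ab(3) by simp
    qed
    \<comment> \<open>Here \<open>y'\<close> lies between the ends of the edge from \<open>y\<close>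
      to \<open>a\<close>, and \<open>b\<close> does not. So at most one of the two neighbours of
      \<open>a\<close> is smaller than \<open>a\<close>, and a larger one must be
      \<open>b\<close>.\<close>
    have left: "False" if y: "y \<in> S" "y' \<in> S" "y < y'" "y' < a" "P a y" for y y'
      using P_iff[OF y(5) y(2) ab(2)] y ab(3) by simp
    obtain y1 y2 where y: "y1 \<in> S" "y2 \<in> S" "y1 \<noteq> a" "y2 \<noteq> a" "y1 \<noteq> y2" "P a y1" "P a y2"
      using nbrs[OF ab(1)] by blast
    then have "a < y1 \<or> a < y2" using left[of y1 y2] left[of y2 y1] by (meson linorder_neqE_nat)
    then have "P a b" using right y by metis
    then show ?thesis by (simp add: P_def)
  qed
qed

section \<open>The extremal graph\<close>

text \<open>Here \<open>d = k - 2\<close>, and one round of gluing a \<open>(k + 1)\<close>-gon and its \<open>k\<close> triangulated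
  \<open>(k - 1)\<close>-gons adds \<open>period d = k\<^sup>2 - 2 * k - 1\<close> vertices. The \<open>(k + 1)\<close>-gon of round \<open>p\<close> consists of
  0 and the junctions \<open>p * period d + j * d\<close> for \<open>1 \<le> j \<le> d + 2\<close>; a hub is a junction
  with \<open>j \<le> d + 1\<close>, where the next \<open>(k - 1)\<close>-gon is triangulated as a fan, and the last fan of each round is centred at 0. The next
  round is glued to the edge from 0 to the largest vertex so far.\<close>
definition period :: "nat \<Rightarrow> nat" where
  "period d = d * (d + 2) - 1"

text \<open>The shift makes \<open>(i - 1) mod period d + 1\<close> run from 1 to
  \<open>period d\<close>; the multiples of \<open>d\<close> in that range are \<open>d\<close> up
  to \<open>d * (d + 1)\<close>.\<close>

definition hub :: "nat \<Rightarrow> nat \<Rightarrow> bool" where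
  "hub d i \<longleftrightarrow> i > 0 \<and> d dvd (i - 1) mod period d + 1"

text \<open>The three disjuncts are the outer path, the fans at 0 and the fans at hubs. The residue
  condition selects the \<open>d\<close> vertices that follow a multiple of
  \<open>period d\<close>.\<close>

definition ext_adj :: "nat \<Rightarrow> nat \<Rightarrow> nat \<Rightarrow> bool" where
  "ext_adj d i j \<longleftrightarrow> i < j \<and>
     (j = Suc i \<or> (i = 0 \<and> (j - 1) mod period d < d) \<or> (hub d i \<and> j \<le> i + d))"

definition ext_graph :: "nat \<Rightarrow> nat \<Rightarrow> nat ugraph" where
  "ext_graph d n = ({..<n}, {{i, j} | i j. j < n \<and> ext_adj d i j})"

lemma period_eq: "d \<ge> 1 \<Longrightarrow> period d + 1 = d * (d + 2)"
  by (cases d) (auto simp: period_def)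

lemma period_ge: "d \<ge> 1 \<Longrightarrow> period d \<ge> d * (d + 1)"
  using period_eq[of d] by (simp add: algebra_simps)

lemma period_pos: "d \<ge> 1 \<Longrightarrow> d \<le> period d" "d \<ge> 1 \<Longrightarrow> 0 < period d"
  using period_ge[of d] by (auto simp: algebra_simps)

text \<open>The residue of a hub leaves room for \<open>d - 1\<close> further vertices before it
  wraps around. So inner vertices of a fan are neither hubs nor in the range joined to 0, which
  gives both noncrossing edges and junctions that no edge jumps over.\<close>

lemma after_hub:
  assumes d: "d \<ge> 1" and a: "hub d a" and c: "a < c" "c < a + d"
  shows "(c - 1) mod period d \<ge> d" "\<not> hub d c"
proof -
  define r where "r = (a - 1) mod period d"
  define t where "t = c - a"
  have t: "0 < t" "t < d" using c by (auto simp: t_def)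
  have dr: "d dvd r + 1" and a0: "a > 0" using a by (auto simp: hub_def r_def)
  obtain q where q: "r + 1 = d * q" using dr by auto
  have "r < period d" using period_pos[OF d] by (simp add: r_def)
  then have "d * q < d * (d + 2)" using period_eq[OF d] q by linarith
  then have "q < d + 2" by (rule mult_less_cancel1[THEN iffD1, THEN conjunct2])
  then have "d * q \<le> d * (d + 1)" by (intro mult_le_mono2) simp
  then have rt: "r + t < period d"
    using period_eq[OF d] q t by (simp add: algebra_simps)
  have "(c - 1) mod period d = ((a - 1) + t) mod period d"
    using a0 c by (simp add: t_def)
  also have "\<dots> = (r + t) mod period d" by (simp add: r_def mod_add_left_eq)
  also have "\<dots> = r + t" using rt by simp
  finally have eq: "(c - 1) mod period d = r + t" .
  have "r + 1 \<ge> d" using dr by (intro dvd_imp_le) auto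
  then show "(c - 1) mod period d \<ge> d" using eq t by simp
  have "\<not> d dvd (r + 1) + t"
    using dr t dvd_add_right_iff[of d "r + 1" t] by (auto dest: dvd_imp_le)
  then show "\<not> hub d c" unfolding hub_def eq by simp
qed

lemma ext_adj_jump:
  assumes d: "d \<ge> 1" and ab: "ext_adj d a b" "a > 0" "a < z" "z < b"
  shows "(z - 1) mod period d \<ge> d" "\<not> hub d z"
proof -
  have "hub d a" "z < a + d" using ab by (auto simp: ext_adj_def)
  then show "(z - 1) mod period d \<ge> d" "\<not> hub d z" using after_hub[OF d _ ab(3)] by blast+
qed

lemma ext_edge_iff: "{x, y} \<in> edges (ext_graph d n) \<longleftrightarrow>
    (y < n \<and> ext_adj d x y) \<or> (x < n \<and> ext_adj d y x)"
  by (auto simp: ext_graph_def doubleton_eq_iff)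

lemma ext_adj_less: "ext_adj d x y \<Longrightarrow> x < y"
  by (simp add: ext_adj_def)

lemma ext_edge_less: "x < y \<Longrightarrow> {x, y} \<in> edges (ext_graph d n) \<longleftrightarrow> y < n \<and> ext_adj d x y"
  unfolding ext_edge_iff by (auto dest: ext_adj_less)

lemma simple_ext_graph: "simple_graph (ext_graph d n)"
  by (auto simp: simple_graph_def ext_graph_def ext_adj_def)

text \<open>If the edge from \<open>c > 0\<close> jumps over \<open>b\<close>, then \<open>c\<close>
  is a hub and \<open>b\<close> is inside its fan. So \<open>b\<close> is not joined to 0, and no
  edge from a positive \<open>a\<close> can jump over the hub \<open>c\<close>.\<close>

lemma noncrossing_ext_graph:
  assumes d: "d \<ge> 1"
  shows "noncrossing_edges (edges (ext_graph d n))"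
  unfolding noncrossing_edges_def
proof (intro allI impI notI)
  fix a b c e assume lt: "a < c \<and> c < b \<and> b < e"
    and "{a, b} \<in> edges (ext_graph d n)" "{c, e} \<in> edges (ext_graph d n)"
  then have adj: "ext_adj d a b" "ext_adj d c e" by (simp_all add: ext_edge_less)
  have "(b - 1) mod period d \<ge> d"
    using ext_adj_jump(1)[OF d adj(2), of b] lt by simp
  moreover have "hub d c" using adj(2) lt by (auto simp: ext_adj_def)
  ultimately show False
    using adj(1) lt ext_adj_jump(2)[OF d adj(1), of c] by (cases "a = 0") (auto simp: ext_adj_def hub_def)
qed

lemma hub_junction:
  assumes d: "d \<ge> 1" and j: "1 \<le> j" "j \<le> d + 1"
  shows "hub d (p * period d + j * d)"
proof -
  have "j * d \<le> d * (d + 1)" using j by (metis mult.commute mult_le_mono2)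
  then have "j * d \<le> period d" using period_ge[OF d] by simp
  moreover have "1 * 1 \<le> j * d" using j d by (intro mult_le_mono) auto
  ultimately have lt: "j * d - 1 < period d" and pos: "0 < j * d" by linarith+
  have "p * period d + j * d - 1 = p * period d + (j * d - 1)" using pos by linarith
  then have "(p * period d + j * d - 1) mod period d = (p * period d + (j * d - 1)) mod period d"
    by (rule arg_cong)
  also have "\<dots> = j * d - 1" using lt by (simp only: mod_mult_self3 mod_less)
  finally have "(p * period d + j * d - 1) mod period d + 1 = j * d" using pos by linarith
  moreover have "0 < p * period d + j * d" using pos by linarith
  ultimately show ?thesis unfolding hub_def by (metis dvd_triv_right)
qed

lemma junction_not_jumped:
  assumes d: "d \<ge> 1" and j: "1 \<le> j" "j \<le> d + 2"
    and ab: "ext_adj d a b" "a > 0"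
  shows "\<not> (a < p * period d + j * d \<and> p * period d + j * d < b)"
proof
  assume *: "a < p * period d + j * d \<and> p * period d + j * d < b"
  note jump = ext_adj_jump[OF d ab, of "p * period d + j * d"]
  show False
  proof (cases "j = d + 2")
    case True
    \<comment> \<open>The last junction of a round need not be a hub; it is protected as a neighbour
      of 0.\<close>
    then have "p * period d + j * d = (p + 1) * period d + 1"
      using period_eq[OF d] by (simp add: algebra_simps)
    then have "(p * period d + j * d - 1) mod period d = 0" by (simp only: diff_add_inverse2 mod_mult_self2_is_0)
    then show False using jump(1) * d by simp
  next
    case False
    then show False using jump(2) * hub_junction[OF d, of j p] j by simp
  qed
qed

text \<open>The hypotheses on \<open>S\<close> are what \<open>noncrossing_cycle\<close> yields for
  the vertices of a \<open>k\<close>-cycle. Without 0, \<open>S\<close> fits into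
  \<open>d + 1\<close> consecutive vertices. With 0, it must contain all \<open>d + 2\<close>
  junctions of some round, hence at least \<open>d + 3\<close> vertices.\<close>

lemma ext_graph_no_cycle:
  assumes d: "d \<ge> 1" and S: "finite S" "card S = d + 2"
    and ends: "ext_adj d (Min S) (Max S)"
    and cons: "\<And>a b. a \<in> S \<Longrightarrow> b \<in> S \<Longrightarrow> a < b \<Longrightarrow> S \<inter> {a<..<b} = {} \<Longrightarrow> ext_adj d a b"
  shows False
proof -
  have ne: "S \<noteq> {}" using S by auto
  have Min: "Min S \<in> S" "\<And>x. x \<in> S \<Longrightarrow> Min S \<le> x"
    and Max: "Max S \<in> S" "\<And>x. x \<in> S \<Longrightarrow> x \<le> Max S"
    using S ne by auto
  \<comment> \<open>The neighbours of \<open>z\<close> in the order of \<open>S\<close> are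
    adjacent, so their edge would jump over \<open>z\<close>.\<close>
  have gap: "\<not> (a \<le> z \<and> z \<le> b)" if ab: "a \<in> S" "b \<in> S" "a > 0" and z: "z \<notin> S"
    "\<And>a b. ext_adj d a b \<Longrightarrow> a > 0 \<Longrightarrow> \<not> (a < z \<and> z < b)" for a b z
  proof
    assume *: "a \<le> z \<and> z \<le> b"
    define a' where "a' = Max {x \<in> S. x \<le> z}"
    define b' where "b' = Min {x \<in> S. z \<le> x}"
    have fin: "finite {x \<in> S. x \<le> z}" "finite {x \<in> S. z \<le> x}" using S by auto
    have "a \<in> {x \<in> S. x \<le> z}" "b \<in> {x \<in> S. z \<le> x}" using ab * by auto
    then have a': "a' \<in> {x \<in> S. x \<le> z}" "a \<le> a'" and b': "b' \<in> {x \<in> S. z \<le> x}"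
      unfolding a'_def b'_def using Max_in[OF fin(1)] Max_ge[OF fin(1)] Min_in[OF fin(2)] by blast+
    have "a' \<noteq> z" "b' \<noteq> z" using a' b' z by auto
    then have lt: "a' < z" "z < b'" using a' b' by auto
    have "x \<le> a' \<or> b' \<le> x" if "x \<in> S" for x
      using that fin unfolding a'_def b'_def by (metis (mono_tags, lifting) Max_ge Min_le mem_Collect_eq nat_le_linear)
    then have "S \<inter> {a'<..<b'} = {}" by fastforce
    then have "ext_adj d a' b'" using a' b' lt by (intro cons) auto
    then show False using z(2)[of a' b'] lt a'(2) ab(3) by simp
  qed
  show False
  proof (cases "Min S = 0")
    case False
    then have "Max S \<le> Min S + d" using ends d by (auto simp: ext_adj_def)
    then have "S \<subseteq> {Min S..Min S + d}" using Min Max by fastforce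
    then have "card S \<le> card {Min S..Min S + d}" by (intro card_mono) auto
    then show False using S by simp
  next
    case True
    define p where "p = (Max S - 1) div period d"
    have t0: "Max S > 0" using ends True by (simp add: ext_adj_def)
    have tm: "(Max S - 1) mod period d < d"
      using ends True d by (auto simp: ext_adj_def hub_def)
    have t: "Max S = p * period d + (Max S - 1) mod period d + 1"
      using t0 by (simp add: p_def)
    have card': "card (S - {0}) = d + 1" using S True Min(1) by simp
    \<comment> \<open>At most \<open>d\<close> vertices lie between the start of the last fan at 0
      and \<open>Max S\<close>, one too few for \<open>S - {0}\<close>. So \<open>S\<close> reaches
      back into an earlier round.\<close>
    have "\<not> S - {0} \<subseteq> {p * period d + 1..Max S}"
    proof
      assume "S - {0} \<subseteq> {p * period d + 1..Max S}"
      then have "card (S - {0}) \<le> card {p * period d + 1..Max S}" by (intro card_mono) auto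
      then show False using card' t tm by simp
    qed
    then obtain y where y: "y \<in> S" "y > 0" "y \<le> p * period d"
      using Max(2) by fastforce
    define x1 where "x1 = Min (S - {0})"
    have "S - {0} \<noteq> {}" using y by auto
    then have x1: "x1 \<in> S" "x1 > 0" and x1_le: "\<And>x. x \<in> S \<Longrightarrow> x > 0 \<Longrightarrow> x1 \<le> x"
      using S Min_in[of "S - {0}"] Min_le[of "S - {0}"] unfolding x1_def by auto
    have "S \<inter> {0<..<x1} = {}" using x1_le by fastforce
    then have "ext_adj d 0 x1" using x1 Min(1) True by (intro cons) auto
    then have x1m: "(x1 - 1) mod period d < d" using d by (auto simp: ext_adj_def hub_def)
    define p1 where "p1 = (x1 - 1) div period d"
    have x1_eq: "x1 = p1 * period d + (x1 - 1) mod period d + 1" using x1 by (simp add: p1_def)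
    have "p1 * period d < p * period d" using x1_eq y x1_le[of y] by linarith
    then have "Suc p1 \<le> p" by simp
    then have "Suc p1 * period d \<le> p * period d" by (rule mult_le_mono1)
    then have le: "p1 * period d + period d + 1 \<le> Max S" using t by simp
    have "p1 * period d + j * d \<in> S" if j: "j \<in> {1..d + 2}" for j
    proof (rule ccontr)
      assume "p1 * period d + j * d \<notin> S"
      then have "\<not> (x1 \<le> p1 * period d + j * d \<and> p1 * period d + j * d \<le> Max S)"
        using gap[OF x1(1) Max(1) x1(2)] junction_not_jumped[OF d] j by simp
      moreover have "1 * d \<le> j * d" using j by (intro mult_le_mono1) simp
      then have "x1 \<le> p1 * period d + j * d" using x1_eq x1m by linarith
      moreover have "j * d \<le> (d + 2) * d" using j by (intro mult_le_mono1) simp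
      then have "p1 * period d + j * d \<le> Max S"
        using le period_eq[OF d] by (simp only: mult.commute)
      ultimately show False by blast
    qed
    then have sub: "insert 0 ((\<lambda>j. p1 * period d + j * d) ` {1..d + 2}) \<subseteq> S"
      using True Min(1) by auto
    have "inj_on (\<lambda>j. p1 * period d + j * d) {1..d + 2}" using d by (auto simp: inj_on_def)
    moreover have "0 \<notin> (\<lambda>j. p1 * period d + j * d) ` {1..d + 2}" using d by auto
    ultimately have "card (insert 0 ((\<lambda>j. p1 * period d + j * d) ` {1..d + 2})) = d + 3"
      by (simp add: card_image)
    then show False using card_mono[OF S(1) sub] S(2) by simp
  qed
qed

lemma ext_graph_cycle_free:
  assumes d: "d \<ge> 1"
  shows "\<not> contains_subgraph (ext_graph d n) (cycle_graph (d + 2))"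
proof
  assume "contains_subgraph (ext_graph d n) (cycle_graph (d + 2))"
  then obtain f where inj: "inj_on f {..<d + 2}"
    and edge: "\<And>i. i < d + 2 \<Longrightarrow> {f i, f (Suc i mod (d + 2))} \<in> edges (ext_graph d n)"
    by (auto simp: contains_subgraph_def cycle_graph_def)
  have k: "3 \<le> d + 2" using d by simp
  note cyc = noncrossing_cycle[OF noncrossing_ext_graph[OF d] k inj edge]
  define S where "S = f ` {..<d + 2}"
  have fin: "finite S" and card: "card S = d + 2" using inj by (simp_all add: S_def card_image)
  have "Min S < Max S"
  proof (rule ccontr)
    assume "\<not> Min S < Max S"
    moreover have "S \<subseteq> {Min S..Max S}" using fin by auto
    ultimately have "card S \<le> card {Max S}"
      by (intro card_mono) (auto simp: not_less)
    then show False using card d by simp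
  qed
  then have "ext_adj d (Min S) (Max S)"
    using cyc(1) by (simp add: S_def ext_edge_less)
  then show False
    using ext_graph_no_cycle[OF d fin card] cyc(2) by (simp add: S_def ext_edge_less)
qed

lemma card_ext_graph:
  assumes d: "d \<ge> 1"
  shows "card (edges (ext_graph d (m * period d + d + 1))) \<ge> (2 * d - 1) * (1 + m * (d + 2))"
proof -
  let ?M = "period d"
  define L where "L = m * ?M + d"
  define P where "P = {(i, j). j \<le> L \<and> ext_adj d i j}"
  \<comment> \<open>Path edges, edges at 0 and fan edges. To keep the families disjoint, the path
    starts at 1, and the fan edges start at \<open>t = 2\<close>. A lower bound suffices, since the
    upper bound holds for every graph of the kind considered.\<close>
  define F1 where "F1 = (\<lambda>i. (i, Suc i)) ` {1..<L}"
  define F2 where "F2 = (\<lambda>(p, r). (0 :: nat, p * ?M + (r + 1))) ` ({..m} \<times> {..<d})"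
  define F3 where "F3 = (\<lambda>((p, j), t). (p * ?M + j * d, p * ?M + j * d + t)) `
    (({..<m} \<times> {1..d + 1}) \<times> {2..d})"
  have M: "d \<le> ?M" "0 < ?M" using period_pos[OF d] by auto
  \<comment> \<open>Remainders run from 1 to \<open>?M\<close> instead of from 0, because
    \<open>j * d\<close> reaches \<open>?M\<close> when \<open>d = 1\<close>.\<close>
  have uniq: "p = p' \<and> x = x'"
    if "p * ?M + x = p' * ?M + x'" "0 < x" "x \<le> ?M" "0 < x'" "x' \<le> ?M" for p x p' x'
  proof -
    have *: "(p * ?M + x - 1) div ?M = p" if "0 < x" "x \<le> ?M" for p x
      by (rule div_nat_eqI) (use that M in \<open>simp_all add: algebra_simps\<close>)
    have "p = p'" using *[of x p] *[of x' p'] that by simp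
    then show ?thesis using that by simp
  qed
  have jd: "0 < j * d" "j * d \<le> ?M" "j * d + d \<le> ?M + 1" if "j \<in> {1..d + 1}" for j
  proof -
    show "0 < j * d" using that d by simp
    have "j * d \<le> (d + 1) * d" using that by (intro mult_le_mono1) auto
    then show "j * d \<le> ?M" "j * d + d \<le> ?M + 1"
      using period_ge[OF d] period_eq[OF d] by (simp_all add: algebra_simps)
  qed
  have "finite P"
    by (rule finite_subset[of _ "{..L} \<times> {..L}"]) (auto simp: P_def ext_adj_def)
  have "F1 \<subseteq> P" by (auto simp: F1_def P_def ext_adj_def)
  moreover have "F2 \<subseteq> P"
  proof
    fix e assume "e \<in> F2"
    then obtain p r where e: "e = (0, p * ?M + (r + 1))" "p \<le> m" "r < d" by (auto simp: F2_def)
    have "p * ?M \<le> m * ?M" using e(2) by simp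
    then have "p * ?M + (r + 1) \<le> L" using e(3) unfolding L_def by linarith
    then show "e \<in> P" using e M by (simp add: P_def ext_adj_def)
  qed
  moreover have "F3 \<subseteq> P"
  proof
    fix e assume "e \<in> F3"
    then obtain p j t where e: "e = (p * ?M + j * d, p * ?M + j * d + t)" "p < m"
      "j \<in> {1..d + 1}" "t \<in> {2..d}" by (auto simp: F3_def)
    have "Suc p * ?M \<le> m * ?M" using e(2) by (intro mult_le_mono1) auto
    then have "p * ?M + j * d + t \<le> L" using e jd[OF e(3)] d by (simp add: L_def)
    then show "e \<in> P" using e hub_junction[OF d, of j p] by (simp add: P_def ext_adj_def)
  qed
  moreover have "F1 \<inter> F2 = {}" by (auto simp: F1_def F2_def)
  moreover have "F2 \<inter> F3 = {}" using d by (auto simp: F2_def F3_def)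
  moreover have "F1 \<inter> F3 = {}" by (auto simp: F1_def F3_def)
  moreover have "finite F1" "finite F2" "finite F3" by (auto simp: F1_def F2_def F3_def)
  ultimately have "card F1 + card F2 + card F3 \<le> card P"
    using card_mono[OF \<open>finite P\<close>, of "F1 \<union> F2 \<union> F3"]
    by (simp add: card_Un_disjoint Int_Un_distrib2)
  moreover have "card F1 = L - 1"
    unfolding F1_def by (subst card_image) (auto simp: inj_on_def)
  moreover have "card F2 = (m + 1) * d"
  proof -
    have "inj_on (\<lambda>(p, r). (0 :: nat, p * ?M + (r + 1))) ({..m} \<times> {..<d})"
    proof (rule inj_onI, clarsimp)
      fix p r p' r' assume "r < d" "r' < d" "p * ?M + r = p' * ?M + r'"
      then show "p = p' \<and> r = r'" using uniq[of p "r + 1" p' "r' + 1"] M by simp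
    qed
    then show ?thesis by (simp add: F2_def card_image)
  qed
  moreover have "card F3 = m * (d + 1) * (d - 1)"
  proof -
    have "inj_on (\<lambda>((p, j), t). (p * ?M + j * d, p * ?M + j * d + t))
      (({..<m} \<times> {1..d + 1}) \<times> {2..d})"
    proof (rule inj_onI)
      fix u v
      assume uv: "u \<in> ({..<m} \<times> {1..d + 1}) \<times> {2..d}" "v \<in> ({..<m} \<times> {1..d + 1}) \<times> {2..d}"
        and eq: "(\<lambda>((p, j), t). (p * ?M + j * d, p * ?M + j * d + t)) u =
          (\<lambda>((p, j), t). (p * ?M + j * d, p * ?M + j * d + t)) v"
      obtain p j t p' j' t' where u: "u = ((p, j), t)" and v: "v = ((p', j'), t')"
        by (metis surj_pair)
      have j: "j \<in> {1..d + 1}" "j' \<in> {1..d + 1}" using uv u v by auto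
      have eqs: "p * ?M + j * d = p' * ?M + j' * d" "t = t'" using eq u v by auto
      have "p = p' \<and> j * d = j' * d"
        by (rule uniq[OF eqs(1)]) (use jd[OF j(1)] jd[OF j(2)] in blast)+
      then show "u = v" using u v eqs(2) d by simp
    qed
    then show ?thesis by (simp add: F3_def card_image card_cartesian_product)
  qed
  moreover have "card P = card (edges (ext_graph d (m * ?M + d + 1)))"
  proof (rule bij_betw_same_card[of "\<lambda>(i, j). {i, j}"], rule bij_betw_imageI)
    show "inj_on (\<lambda>(i, j). {i, j}) P"
      by (auto simp: inj_on_def P_def doubleton_eq_iff dest!: ext_adj_less)
    show "(\<lambda>(i, j). {i, j}) ` P = edges (ext_graph d (m * ?M + d + 1))"
      by (auto simp: P_def L_def ext_graph_def image_iff less_Suc_eq_le)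
  qed
  moreover have "(L - 1) + (m + 1) * d + m * (d + 1) * (d - 1) = (2 * d - 1) * (1 + m * (d + 2))"
  proof -
    obtain c where c: "d = Suc c" using d by (cases d) auto
    have "L = m * (c * c + 4 * c + 2) + Suc c"
      by (simp add: L_def c period_def algebra_simps)
    then show ?thesis by (simp add: c algebra_simps)
  qed
  ultimately show ?thesis by linarith
qed

section \<open>The outerplanar Turan number\<close>

lemma is_cycle_contains_subgraph:
  assumes G: "simple_graph G" and k: "k \<ge> 3"
    and xs: "is_cycle (edges G) xs" "length xs = k"
  shows "contains_subgraph G (cycle_graph k)"
proof -
  have path: "is_path (edges G) xs" and last: "{last xs, hd xs} \<in> edges G" and dist: "distinct xs"
    using xs by (auto simp: is_cycle_def)
  have edge: "{xs ! i, xs ! (Suc i mod k)} \<in> edges G" if "i < k" for i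
  proof (cases "Suc i = k")
    case True
    then have "xs \<noteq> []" "i = length xs - 1" using xs k by auto
    then have "last xs = xs ! i" "hd xs = xs ! 0" by (simp_all add: hd_conv_nth last_conv_nth)
    moreover have "Suc i mod k = 0" using True by simp
    ultimately show ?thesis using last by simp
  next
    case False
    then show ?thesis using successively_nth[OF path, of i] that xs(2) by simp
  qed
  have "xs ! i \<in> vertices G" if "i < k" for i
    using edge[OF that] G by (auto simp: simple_graph_def)
  then show ?thesis
    unfolding contains_subgraph_def cycle_graph_def
    using edge xs(2) dist by (intro exI[of _ "(!) xs"]) (auto intro!: inj_on_nth)
qed

lemma outerplanar_cycle_free_bound:
  fixes G :: "'a ugraph"
  assumes k: "k \<ge> 3" and G: "simple_graph G" "outerplanar G" "\<not> contains_subgraph G (cycle_graph k)"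
    and n: "card (vertices G) \<ge> 2"
  shows "((int k)^2 - 2 * int k - 1) * int (card (edges G)) \<le>
    (2 * int k - 5) * (int k * (int (card (vertices G)) - 1) - 1)"
proof -
  interpret turan_graph "edges G" k
    using k G outerplanar_theta_K4_free[OF G(1,2)] is_cycle_contains_subgraph[OF G(1) k]
    by unfold_locales (auto simp: simple_graph_def)
  have "finite (vertices G)" using G(1) by (simp add: simple_graph_def)
  moreover have "vertices G \<noteq> {}" using n by auto
  moreover have "{e \<in> edges G. e \<subseteq> vertices G} = edges G" using G(1) by (auto simp: simple_graph_def)
  ultimately show ?thesis using edge_bound[of "vertices G"] n by simp
qed

lemma ex_OP_eqI:
  fixes H :: "'b ugraph"
  assumes "\<And>G :: nat ugraph. simple_graph G \<Longrightarrow> card (vertices G) = n \<Longrightarrow> outerplanar G \<Longrightarrow>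
      \<not> contains_subgraph G H \<Longrightarrow> card (edges G) \<le> e"
    and "simple_graph (G :: nat ugraph)" "card (vertices G) = n" "outerplanar G"
      "\<not> contains_subgraph G H" "e \<le> card (edges G)"
  shows "ex_OP n H = e"
  unfolding ex_OP_def
proof (rule Max_eqI)
  let ?S = "{card (edges G) | G :: nat ugraph.
     simple_graph G \<and> card (vertices G) = n \<and> outerplanar G \<and> \<not> contains_subgraph G H}"
  have "?S \<subseteq> {..e}" using assms(1) by blast
  then show "finite ?S" by (rule finite_subset) simp
  show "y \<le> e" if "y \<in> ?S" for y using that assms(1) by blast
  have "card (edges G) = e" using assms(1)[OF assms(2-5)] assms(6) by simp
  then show "e \<in> ?S" using assms(2-5) by blast
qed

theorem theorem3:
  fixes k n :: nat
  assumes "k \<ge> 3"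
    and "n > 0"
    and "[int n = int k - 1] (mod (int k ^ 2 - 2 * int k - 1))"
  shows "real (ex_OP n (cycle_graph k)) =
    (2 * real k - 5) * (real k * real n - real k - 1) / (real k ^ 2 - 2 * real k - 1)"
proof -
  define d where "d = k - 2"
  have d: "d \<ge> 1" and k: "k = d + 2" using assms(1) by (auto simp: d_def)
  define M where "M = int k ^ 2 - 2 * int k - 1"
  have M_period: "M = int (period d)"
  proof -
    have "int (period d) + 1 = int d * (int d + 2)"
      using period_eq[OF d] by (metis of_nat_1 of_nat_add of_nat_mult of_nat_numeral)
    then show ?thesis by (simp add: M_def k algebra_simps power2_eq_square)
  qed
  have M_pos: "M > 0" using period_pos(2)[OF d] M_period by simp
  \<comment> \<open>This excludes negative \<open>q\<close>: already \<open>k - 1 - M\<close> is not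
    positive. So \<open>n\<close> is the size of one fan followed by \<open>q\<close> complete
    rounds.\<close>
  have M_ge: "M \<ge> int k - 1"
  proof -
    have "0 \<le> int k * (int k - 3)" using assms(1) by simp
    then show ?thesis by (simp add: M_def algebra_simps power2_eq_square)
  qed
  obtain q where q: "int n = int k - 1 + M * q"
    using cong_sym[OF assms(3)] unfolding M_def cong_iff_lin by blast
  have "q \<ge> 0"
  proof (rule ccontr)
    assume "\<not> q \<ge> 0"
    then have "M * q \<le> M * (- 1)" using M_pos by (intro mult_left_mono) auto
    then show False using q M_ge assms(2) by simp
  qed
  then obtain m where m: "q = int m" using nonneg_int_cases by blast
  have n_int: "int n = int (m * period d + d + 1)"
    using q unfolding m M_period by (simp add: k)
  then have n: "n = m * period d + d + 1" by linarith
  \<comment> \<open>There are \<open>1 + m * k\<close> triangulated (k - 1)-gons with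
    \<open>2 * k - 5\<close> edges each, and every edge of the construction lies in exactly one of
    them.\<close>
  let ?e = "(2 * d - 1) * (1 + m * (d + 2))"
  have "int (2 * d - 1) = 2 * int k - 5" using d k by linarith
  then have e_int: "int ?e = (2 * int k - 5) * (1 + int m * int k)"
    by (simp only: of_nat_mult of_nat_add of_nat_1 k)
  have count: "(2 * int k - 5) * (int k * (int n - 1) - 1) = M * int ?e"
  proof -
    have "int k * (int n - 1) - 1 = M * (1 + int m * int k)"
      unfolding q m by (simp add: M_def algebra_simps power2_eq_square)
    then show ?thesis unfolding e_int by (simp add: algebra_simps)
  qed
  have ex: "ex_OP n (cycle_graph k) = ?e"
  proof (rule ex_OP_eqI)
    fix G :: "nat ugraph"
    assume G: "simple_graph G" "card (vertices G) = n" "outerplanar G"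
      "\<not> contains_subgraph G (cycle_graph k)"
    have "M * int (card (edges G)) \<le> M * int ?e"
      using outerplanar_cycle_free_bound[OF assms(1) G(1,3,4)] G(2) n d count
      by (simp add: M_def)
    then have "int (card (edges G)) \<le> int ?e" using M_pos by (simp only: mult_le_cancel_left_pos)
    then show "card (edges G) \<le> ?e" by (simp only: of_nat_le_iff)
  next
    show "simple_graph (ext_graph d n)" by (rule simple_ext_graph)
    show "card (vertices (ext_graph d n)) = n" by (simp add: ext_graph_def)
    show "outerplanar (ext_graph d n)"
      by (rule outerplanar_if_noncrossing[OF simple_ext_graph noncrossing_ext_graph[OF d]])
    show "\<not> contains_subgraph (ext_graph d n) (cycle_graph k)"
      unfolding k by (rule ext_graph_cycle_free[OF d])
    show "?e \<le> card (edges (ext_graph d n))"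
      unfolding n by (rule card_ext_graph[OF d])
  qed
  have "real_of_int M * real ?e = (2 * real k - 5) * (real k * (real n - 1) - 1)"
    using arg_cong[OF count, of real_of_int] by (simp del: of_nat_mult)
  moreover have "real_of_int M = real k ^ 2 - 2 * real k - 1" by (simp add: M_def)
  moreover have "real_of_int M > 0" using M_pos by simp
  ultimately show ?thesis unfolding ex by (simp add: field_simps del: of_nat_mult)
qed

end
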